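(* Let $K:\ell^2\to H_2$ be linear and bounded, $1<q\le2$, $r=q/(q-1)$, and let $J:\ell^2\to\mathbb{R}\cup\{\infty\}$ be $J(u)=\sum_{k\in\mathbb{N}}|u_k|^q$ if $u\in\ell^q$ and $J(u)=+\infty$ otherwise. Let $\delta_k>0$, $\delta_k\to0$, and $g_k\in H_2$ with $\|g_k-g\|\le\delta_k$. Let $\Gamma$ be the parameter choice according to Morozov's discrepancy principle with parameter $\rho>1$. If the $J$-minimizing solution $u^\dagger$ of $Ku=g$ satisfies the source condition $K^*p^\dagger\in\partial J(u^\dagger)$ with a source element $p^\dagger\in H_2$, then the following convergence rates hold for $k$ sufficiently large: $$\|\mathcal{R}_{\Gamma(\delta_k,g_k)}(g_k)-u^\dagger\|_{\ell^q}=\mathcal{O}(\sqrt{\delta_k}),$$ $$\|K^*\mathcal{R}^*_{\Gamma(\delta_k,g_k)}(g_k)-K^*p^\dagger\|_{\ell^r}=\mathcal{O}\big(\delta_k^{\frac{q-1}{q}}\big).$$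
   Context: $H_2$ is a separable (real) Hilbert space, $H_1=\ell^2$, and $K^*$ is the adjoint of $K$. The element $g\in H_2$ is attainable: $Ku=g$ for some $u$ with $J(u)<\infty$. A $J$-minimizing solution of $Ku=g$ is a minimizer of $J(u)$ subject to $Ku=g$. The subdifferential $\partial J$ is taken in $\ell^2$. Augmented Lagrangian method: $\{\tau_n\}_{n\ge1}$ is a fixed sequence of positive numbers, $t_n:=\sum_{k=1}^n\tau_k$, with $t_n\to+\infty$ and $\sup_k\tau_k<\infty$. Given data $g^\delta$ and a fixed starting element $p_0^\delta=p_0\in H_2$, for $n=1,2,\dots$ $$u_n^\delta\in\operatorname{argmin}_{u\in\ell^2}\Big(\tfrac{\tau_n}{2}\|Ku-g^\delta\|^2+J(u)-\langle p_{n-1}^\delta,Ku-g^\delta\rangle\Big),\qquad p_n^\delta=p_{n-1}^\delta+\tau_n(g^\delta-Ku_n^\delta).$$ Set $\mathcal{R}_n(g^\delta):=u_n^\delta$ and $\mathcal{R}_n^*(g^\delta):=p_n^\delta$. Morozov's discrepancy principle with $\rho>1$ is the stopping rule $\Gamma(\delta,g^\delta):=\min\{n\in\mathbb{N}, n\ge1:\ \|Ku_n^\delta-g^\delta\|<\rho\delta\}$ (this minimum exists whenever $\|g^\delta-g\|\le\delta$). *)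

theory Defs
  imports "HOL-Analysis.Analysis" "HOL-Library.Landau_Symbols"
begin

section \<open>The real Hilbert space of square summable sequences\<close>

typedef l2 = "{x :: nat \<Rightarrow> real. summable (\<lambda>k. (x k)\<^sup>2)}"
  morphisms l2_nth Abs_l2
  by (rule exI[of _ "\<lambda>_. 0"]) simp

setup_lifting type_definition_l2

lemma summable_square_mult:
  fixes x y :: "nat \<Rightarrow> real"
  assumes "summable (\<lambda>k. (x k)\<^sup>2)" "summable (\<lambda>k. (y k)\<^sup>2)"
  shows "summable (\<lambda>k. x k * y k)"
proof (rule summable_comparison_test')
  show "summable (\<lambda>k. (x k)\<^sup>2 + (y k)\<^sup>2)"
    using assms by (rule summable_add)
  show "norm (x k * y k) \<le> (x k)\<^sup>2 + (y k)\<^sup>2" if "k \<ge> 0" for k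
  proof -
    have "2 * (\<bar>x k\<bar> * \<bar>y k\<bar>) \<le> (x k)\<^sup>2 + (y k)\<^sup>2"
      using sum_squares_bound[of "\<bar>x k\<bar>" "\<bar>y k\<bar>"] by (simp add: mult.assoc)
    moreover have "0 \<le> \<bar>x k\<bar> * \<bar>y k\<bar>" by simp
    ultimately show ?thesis unfolding real_norm_def abs_mult by linarith
  qed
qed

lemma summable_square_add:
  fixes x y :: "nat \<Rightarrow> real"
  assumes "summable (\<lambda>k. (x k)\<^sup>2)" "summable (\<lambda>k. (y k)\<^sup>2)"
  shows "summable (\<lambda>k. (x k + y k)\<^sup>2)"
proof -
  have "summable (\<lambda>k. (x k)\<^sup>2 + (y k)\<^sup>2 + 2 * (x k * y k))"
    by (intro summable_add summable_mult assms summable_square_mult)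
  then show ?thesis by (simp add: power2_sum mult.assoc)
qed

lemma summable_square_scale:
  fixes x :: "nat \<Rightarrow> real"
  assumes "summable (\<lambda>k. (x k)\<^sup>2)"
  shows "summable (\<lambda>k. (c * x k)\<^sup>2)"
  using summable_mult[OF assms, of "c\<^sup>2"] by (simp add: power_mult_distrib)

instantiation l2 :: real_vector
begin

lift_definition zero_l2 :: l2 is "\<lambda>_. 0" by simp
lift_definition plus_l2 :: "l2 \<Rightarrow> l2 \<Rightarrow> l2" is "\<lambda>x y k. x k + y k"
  by (rule summable_square_add)
lift_definition uminus_l2 :: "l2 \<Rightarrow> l2" is "\<lambda>x k. - x k" by simp
lift_definition minus_l2 :: "l2 \<Rightarrow> l2 \<Rightarrow> l2" is "\<lambda>x y k. x k - y k"
proof -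
  fix x y :: "nat \<Rightarrow> real"
  assume "summable (\<lambda>k. (x k)\<^sup>2)" "summable (\<lambda>k. (y k)\<^sup>2)"
  then show "summable (\<lambda>k. (x k - y k)\<^sup>2)"
    using summable_square_add[of x "\<lambda>k. - y k"] by simp
qed
lift_definition scaleR_l2 :: "real \<Rightarrow> l2 \<Rightarrow> l2" is "\<lambda>c x k. c * x k"
  by (rule summable_square_scale)

instance
  by standard (transfer; simp add: algebra_simps fun_eq_iff)+

end

instantiation l2 :: real_inner
begin

lift_definition inner_l2 :: "l2 \<Rightarrow> l2 \<Rightarrow> real" is "\<lambda>x y. \<Sum>k. x k * y k" .

definition norm_l2 :: "l2 \<Rightarrow> real" where "norm_l2 x = sqrt (inner x x)"
definition sgn_l2 :: "l2 \<Rightarrow> l2" where "sgn_l2 x = x /\<^sub>R norm x"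
definition dist_l2 :: "l2 \<Rightarrow> l2 \<Rightarrow> real" where "dist_l2 x y = norm (x - y)"
definition uniformity_l2 :: "(l2 \<times> l2) filter"
  where "uniformity_l2 = (INF e\<in>{0<..}. principal {(x, y). dist x y < e})"
definition open_l2 :: "l2 set \<Rightarrow> bool"
  where "open_l2 U \<longleftrightarrow> (\<forall>x\<in>U. eventually (\<lambda>(x', y). x' = x \<longrightarrow> y \<in> U) uniformity)"

instance
proof
  fix x y z :: l2 and r :: real
  show "inner x y = inner y x"
    by transfer (simp add: mult.commute)
  show "inner (x + y) z = inner x z + inner y z"
    by transfer (simp add: distrib_right suminf_add summable_square_mult)
  show "inner (r *\<^sub>R x) y = r * inner x y"
    by transfer (simp add: mult.assoc suminf_mult summable_square_mult)
  show "0 \<le> inner x x"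
    by transfer (simp add: suminf_nonneg flip: power2_eq_square)
  show "(inner x x = 0) = (x = 0)"
    by transfer (simp add: suminf_eq_zero_iff fun_eq_iff flip: power2_eq_square)
qed (simp_all only: norm_l2_def sgn_l2_def dist_l2_def uniformity_l2_def open_l2_def)

end

lemma summable_l2_nth: "summable (\<lambda>k. (l2_nth x k)\<^sup>2)"
  using l2_nth[of x] by simp

lemma l2_nth_minus: "l2_nth (x - y) k = l2_nth x k - l2_nth y k"
  by (simp add: minus_l2.rep_eq)

lemma inner_l2_eq: "inner x y = (\<Sum>k. l2_nth x k * l2_nth y k)"
  by (simp add: inner_l2.rep_eq)

lemma norm_l2_square: "(norm x)\<^sup>2 = (\<Sum>k. (l2_nth x k)\<^sup>2)"
  unfolding power2_norm_eq_inner inner_l2_eq by (simp add: power2_eq_square)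

lemma sum_l2_nth_le_norm: "(\<Sum>k<m. (l2_nth x k)\<^sup>2) \<le> (norm x)\<^sup>2"
  unfolding norm_l2_square by (intro sum_le_suminf summable_l2_nth) auto

lemma abs_l2_nth_le_norm: "\<bar>l2_nth x k\<bar> \<le> norm x"
proof -
  have "(l2_nth x k)\<^sup>2 \<le> (\<Sum>j<Suc k. (l2_nth x j)\<^sup>2)"
    by (simp add: sum_nonneg)
  also have "\<dots> \<le> (norm x)\<^sup>2" by (rule sum_l2_nth_le_norm)
  finally show ?thesis
    by (metis abs_le_square_iff abs_norm_cancel)
qed

instance l2 :: complete_space
proof
  fix X :: "nat \<Rightarrow> l2"
  assume X: "Cauchy X"
  have "Cauchy (\<lambda>n. l2_nth (X n) k)" for k
  proof (rule metric_CauchyI)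
    fix e :: real assume "e > 0"
    then obtain M where M: "\<And>m n. m \<ge> M \<Longrightarrow> n \<ge> M \<Longrightarrow> norm (X m - X n) < e"
      using X unfolding Cauchy_def dist_norm by meson
    have "dist (l2_nth (X m) k) (l2_nth (X n) k) < e" if "m \<ge> M" "n \<ge> M" for m n
      using abs_l2_nth_le_norm[of "X m - X n" k] M[OF that] by (simp add: dist_norm l2_nth_minus)
    then show "\<exists>M. \<forall>m\<ge>M. \<forall>n\<ge>M. dist (l2_nth (X m) k) (l2_nth (X n) k) < e"
      by blast
  qed
  then have "\<exists>l. (\<lambda>n. l2_nth (X n) k) \<longlonglongrightarrow> l" for k
    using Cauchy_convergent convergent_def by blast
  then obtain L where L: "\<And>k. (\<lambda>n. l2_nth (X n) k) \<longlonglongrightarrow> L k" by metis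
  have tail: "\<exists>M. \<forall>m\<ge>M. summable (\<lambda>k. (l2_nth (X m) k - L k)\<^sup>2) \<and>
      (\<Sum>k. (l2_nth (X m) k - L k)\<^sup>2) \<le> e\<^sup>2" if "e > 0" for e :: real
  proof -
    obtain M where M: "\<And>m n. m \<ge> M \<Longrightarrow> n \<ge> M \<Longrightarrow> norm (X m - X n) < e"
      using X \<open>e > 0\<close> unfolding Cauchy_def dist_norm by meson
    have *: "(\<Sum>k<j. (l2_nth (X m) k - L k)\<^sup>2) \<le> e\<^sup>2" if "m \<ge> M" for m j
    proof (rule LIMSEQ_le_const2)
      show "(\<lambda>n. \<Sum>k<j. (l2_nth (X m) k - l2_nth (X n) k)\<^sup>2)
          \<longlonglongrightarrow> (\<Sum>k<j. (l2_nth (X m) k - L k)\<^sup>2)"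
        by (intro tendsto_intros L)
      have "(\<Sum>k<j. (l2_nth (X m) k - l2_nth (X n) k)\<^sup>2) \<le> e\<^sup>2" if "n \<ge> M" for n
      proof -
        have "(\<Sum>k<j. (l2_nth (X m) k - l2_nth (X n) k)\<^sup>2) \<le> (norm (X m - X n))\<^sup>2"
          using sum_l2_nth_le_norm[of "X m - X n" j] by (simp add: l2_nth_minus)
        also have "\<dots> \<le> e\<^sup>2"
          using M[OF \<open>m \<ge> M\<close> that] by (intro power_mono) auto
        finally show ?thesis .
      qed
      then show "\<exists>N. \<forall>n\<ge>N. (\<Sum>k<j. (l2_nth (X m) k - l2_nth (X n) k)\<^sup>2) \<le> e\<^sup>2" by blast
    qed
    have "summable (\<lambda>k. (l2_nth (X m) k - L k)\<^sup>2)" if "m \<ge> M" for m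
      by (rule summableI_nonneg_bounded[where x = "e\<^sup>2"]) (use *[OF that] in auto)
    moreover from this have "(\<Sum>k. (l2_nth (X m) k - L k)\<^sup>2) \<le> e\<^sup>2" if "m \<ge> M" for m
      using suminf_le_const[OF _ *[OF that]] that by blast
    ultimately show ?thesis by blast
  qed
  obtain M where "summable (\<lambda>k. (l2_nth (X M) k - L k)\<^sup>2)"
    using tail[OF zero_less_one] by blast
  then have "summable (\<lambda>k. (l2_nth (X M) k + (- 1) * (l2_nth (X M) k - L k))\<^sup>2)"
    by (intro summable_square_add summable_square_scale summable_l2_nth)
  then have sL: "summable (\<lambda>k. (L k)\<^sup>2)" by simp
  define l where "l = Abs_l2 L"
  have l: "l2_nth l = L" unfolding l_def using sL by (simp add: Abs_l2_inverse)
  have "X \<longlonglongrightarrow> l"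
  proof (rule metric_LIMSEQ_I)
    fix e :: real assume "e > 0"
    then obtain M where M: "\<And>m. m \<ge> M \<Longrightarrow> (\<Sum>k. (l2_nth (X m) k - L k)\<^sup>2) \<le> (e / 2)\<^sup>2"
      using tail[OF half_gt_zero[OF \<open>e > 0\<close>]] by meson
    have "dist (X m) l < e" if "m \<ge> M" for m
    proof -
      have "(norm (X m - l))\<^sup>2 \<le> (e / 2)\<^sup>2"
        using M[OF that] unfolding norm_l2_square l2_nth_minus l .
      then have "norm (X m - l) \<le> e / 2"
        by (rule power2_le_imp_le) (use \<open>e > 0\<close> in simp)
      then show ?thesis using \<open>e > 0\<close> by (simp add: dist_norm)
    qed
    then show "\<exists>M. \<forall>m\<ge>M. dist (X m) l < e" by blast
  qed
  then show "convergent X" by (auto simp: convergent_def)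
qed


section \<open>Sequence space norms and the penalty functional\<close>

definition in_lp :: "real \<Rightarrow> (nat \<Rightarrow> real) \<Rightarrow> bool"
  where "in_lp s x \<longleftrightarrow> summable (\<lambda>k. \<bar>x k\<bar> powr s)"

text \<open>The norm is only meaningful together with \<^term>\<open>in_lp s x\<close>.\<close>

definition lp_norm :: "real \<Rightarrow> (nat \<Rightarrow> real) \<Rightarrow> real"
  where "lp_norm s x = (\<Sum>k. \<bar>x k\<bar> powr s) powr (1 / s)"

definition lq_penalty :: "real \<Rightarrow> l2 \<Rightarrow> ereal"
  where "lq_penalty q u =
    (if in_lp q (l2_nth u) then ereal (\<Sum>k. \<bar>l2_nth u k\<bar> powr q) else \<infinity>)"

definition subdifferential :: "('a::real_inner \<Rightarrow> ereal) \<Rightarrow> 'a \<Rightarrow> 'a set"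
  where "subdifferential J u =
    {\<xi>. \<bar>J u\<bar> \<noteq> \<infinity> \<and> (\<forall>v. J u + ereal (\<xi> \<bullet> (v - u)) \<le> J v)}"


section \<open>Augmented Lagrangian method and discrepancy principle\<close>

definition aug_lagrangian ::
  "('a::real_inner \<Rightarrow> 'b::real_inner) \<Rightarrow> ('a \<Rightarrow> ereal) \<Rightarrow> real \<Rightarrow> 'b \<Rightarrow> 'b \<Rightarrow> 'a \<Rightarrow> ereal"
  where "aug_lagrangian K J t p y u =
    ereal (t / 2 * (norm (K u - y))\<^sup>2) + J u - ereal (p \<bullet> (K u - y))"

text \<open>
  The pair \<open>(u, p)\<close> is a sequence of iterates for the data \<open>y\<close>. Only \<open>u n\<close> and \<open>\<tau> n\<close> with
  \<open>n \<ge> 1\<close> are constrained; \<open>u 0\<close> and \<open>\<tau> 0\<close> play no role.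
\<close>

definition alm_iterates ::
  "('a::real_inner \<Rightarrow> 'b::real_inner) \<Rightarrow> ('a \<Rightarrow> ereal) \<Rightarrow> (nat \<Rightarrow> real) \<Rightarrow> 'b \<Rightarrow> 'b \<Rightarrow>
    (nat \<Rightarrow> 'a) \<Rightarrow> (nat \<Rightarrow> 'b) \<Rightarrow> bool"
  where "alm_iterates K J \<tau> p0 y u p \<longleftrightarrow>
    p 0 = p0 \<and>
    (\<forall>n\<ge>1. is_arg_min (aug_lagrangian K J (\<tau> n) (p (n - 1)) y) (\<lambda>_. True) (u n) \<and>
           p n = p (n - 1) + \<tau> n *\<^sub>R (y - K (u n)))"

text \<open>Here \<open>R n y\<close> is the \<open>n\<close>-th primal iterate for the data \<open>y\<close>.\<close>

definition morozov ::
  "('a::real_inner \<Rightarrow> 'b::real_inner) \<Rightarrow> (nat \<Rightarrow> 'b \<Rightarrow> 'a) \<Rightarrow> real \<Rightarrow> real \<Rightarrow> 'b \<Rightarrow> nat"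
  where "morozov K R \<rho> \<delta> y = (LEAST n. n \<ge> 1 \<and> norm (K (R n y) - y) < \<rho> * \<delta>)"

end

theory Submission
  imports Defs
begin

text \<open>
  The optimality condition of the augmented Lagrangian step reads \<open>K\<^sup>* p\<^sub>n \<in> \<partial>J u\<^sub>n\<close>, so the
  dual iterates \<open>p\<^sub>n\<close> are proximal point steps. While the residual exceeds \<open>\<rho> \<delta>\<close>, the Bregman
  distance of \<open>u\<^sup>\<dagger>\<close> to the iterates decreases by a multiple of \<open>\<tau>\<^sub>n \<delta>\<^sup>2\<close>, and comparison
  with the source element shows that it is of order \<open>\<delta>\<close> at time \<open>t\<^sub>n \<approx> 1 / \<delta>\<close>. Hence the
  discrepancy principle stops at a time \<open>t\<^sub>n = O(1 / \<delta>)\<close>. As \<open>\<parallel>p\<^sub>n - p\<^sup>\<dagger>\<parallel>\<close> grows by at most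
  \<open>\<tau>\<^sub>n \<delta>\<close> per step, it is bounded at the stopping index, where the symmetric Bregman distance
  \<open>\<langle>p\<^sub>n - p\<^sup>\<dagger>, K u\<^sub>n - g\<rangle>\<close> is therefore \<open>O(\<delta>)\<close>. Its coordinatewise expansion dominates both the
  \<open>r\<close>-th power of the dual distance in \<open>l\<^sup>r\<close> and, on bounded sets, the square of the primal distance
  in \<open>l\<^sup>q\<close>.
\<close>

section \<open>Dual iterates and the stopping time\<close>

text \<open>
  Here \<open>w n\<close> plays the role of \<open>K u\<^sub>n\<close> and \<open>j n\<close> that of \<open>J u\<^sub>n\<close>, so that the
  optimality conditions become inequalities in the data space only.
\<close>

locale dual_iterates =
  fixes p w :: "nat \<Rightarrow> 'b::real_inner" and j \<tau> :: "nat \<Rightarrow> real"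
    and y g p_dag :: 'b and j_dag \<delta> :: real
  assumes step_pos: "n \<ge> 1 \<Longrightarrow> 0 < \<tau> n"
    and update: "n \<ge> 1 \<Longrightarrow> p n = p (n - 1) + \<tau> n *\<^sub>R (y - w n)"
    and subgrad_dag: "n \<ge> 1 \<Longrightarrow> j n + p n \<bullet> (g - w n) \<le> j_dag"
    and source_subgrad: "n \<ge> 1 \<Longrightarrow> j_dag + p_dag \<bullet> (w n - g) \<le> j n"
    and subgrad: "n \<ge> 1 \<Longrightarrow> m \<ge> 1 \<Longrightarrow> j n + p n \<bullet> (w m - w n) \<le> j m"
    and noise_level: "norm (y - g) \<le> \<delta>"
begin

text \<open>The Bregman distance of J between u_dag and u_n for the subgradient K* p_n, moved to the
  data space through <K* p_n, u_dag - u_n> = <p_n, g - K u_n>.\<close>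

definition bregman :: "nat \<Rightarrow> real"
  where "bregman n = j_dag - j n - p n \<bullet> (g - w n)"

definition elapsed :: "nat \<Rightarrow> real"
  where "elapsed n = (\<Sum>k=1..n. \<tau> k)"

abbreviation dual_error :: "nat \<Rightarrow> real"
  where "dual_error n \<equiv> norm (p n - p_dag)"

section \<open>Growth of the dual error and decay of the Bregman distance\<close>

lemma noise_level_nonneg: "0 \<le> \<delta>"
  using noise_level norm_ge_zero order_trans by blast

lemma bregman_nonneg: "n \<ge> 1 \<Longrightarrow> 0 \<le> bregman n"
  using subgrad_dag[of n] by (simp add: bregman_def)

text \<open>The right-hand side is the symmetric Bregman distance: it exceeds
  \<open>bregman n\<close> by the distance in the opposite direction, which is nonnegative by the
  source condition.\<close>

lemma bregman_le_symmetric: "n \<ge> 1 \<Longrightarrow> bregman n \<le> (w n - g) \<bullet> (p n - p_dag)"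
  using source_subgrad[of n] by (simp add: bregman_def inner_diff algebra_simps inner_commute)

lemma elapsed_Suc: "elapsed (Suc n) = elapsed n + \<tau> (Suc n)"
  by (simp add: elapsed_def)

lemma elapsed_mono: "m \<le> n \<Longrightarrow> elapsed m \<le> elapsed n"
proof (rule lift_Suc_mono_le[of elapsed])
  show "elapsed k \<le> elapsed (Suc k)" for k
    using step_pos[of "Suc k"] by (simp add: elapsed_Suc)
qed

lemma elapsed_nonneg: "0 \<le> elapsed n"
  using elapsed_mono[of 0 n] by (simp add: elapsed_def)

text \<open>Three-point identity for the implicit step. In \<open>y - w = (y - g) - (w - g)\<close>
  the noise part is bounded by Cauchy-Schwarz, the rest by the symmetric Bregman distance.\<close>

lemma dual_error_step:
  "(dual_error (Suc n))\<^sup>2 / 2 + (norm (p (Suc n) - p n))\<^sup>2 / 2 + \<tau> (Suc n) * bregman (Suc n)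
    \<le> (dual_error n)\<^sup>2 / 2 + \<tau> (Suc n) * (\<delta> * dual_error (Suc n))"
proof -
  let ?t = "\<tau> (Suc n)" and ?w = "w (Suc n)" and ?p = "p (Suc n)"
  have t: "0 < ?t" by (simp add: step_pos)
  have d: "?p - p n = ?t *\<^sub>R (y - ?w)" using update[of "Suc n"] by simp
  have "(dual_error (Suc n))\<^sup>2 / 2 + (norm (?p - p n))\<^sup>2 / 2 - (dual_error n)\<^sup>2 / 2
      = (?p - p n) \<bullet> (?p - p_dag)"
    unfolding power2_norm_eq_inner by (simp add: inner_diff inner_commute field_simps)
  also have "\<dots> = ?t * ((y - g) \<bullet> (?p - p_dag) - (?w - g) \<bullet> (?p - p_dag))"
    unfolding d by (simp add: inner_diff_left)
  also have "\<dots> \<le> ?t * (\<delta> * dual_error (Suc n) - bregman (Suc n))"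
  proof -
    have "(y - g) \<bullet> (?p - p_dag) \<le> \<delta> * dual_error (Suc n)"
      using norm_cauchy_schwarz[of "y - g" "?p - p_dag"] noise_level
      by (meson mult_right_mono norm_ge_zero order_trans)
    then show ?thesis
      using bregman_le_symmetric[of "Suc n"] t by (intro mult_left_mono) auto
  qed
  finally show ?thesis by (simp add: algebra_simps)
qed

text \<open>The squared increment on the left of \<open>dual_error_step\<close> dominates (a - b)^2
  for an increase from b to a, so the step estimate becomes a (a - b) \<le> a \<tau> \<delta>, and a
  cancels.\<close>

lemma dual_error_Suc_le: "dual_error (Suc n) \<le> dual_error n + \<tau> (Suc n) * \<delta>"
proof (rule ccontr)
  let ?a = "dual_error (Suc n)" and ?b = "dual_error n"
  assume "\<not> ?thesis"
  then have *: "\<tau> (Suc n) * \<delta> < ?a - ?b" by simp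
  have t: "0 < \<tau> (Suc n)" by (simp add: step_pos)
  with * have ab: "0 < ?a - ?b"
    using noise_level_nonneg by (smt (verit) mult_nonneg_nonneg)
  have "?a - ?b \<le> norm (p (Suc n) - p n)"
    using norm_triangle_ineq2[of "p (Suc n) - p_dag" "p n - p_dag"] by simp
  then have "(?a - ?b)\<^sup>2 \<le> (norm (p (Suc n) - p n))\<^sup>2"
    using ab by (intro power_mono) auto
  moreover have "0 \<le> \<tau> (Suc n) * bregman (Suc n)"
    using t bregman_nonneg[of "Suc n"] by simp
  ultimately have "?a\<^sup>2 / 2 + (?a - ?b)\<^sup>2 / 2 \<le> ?b\<^sup>2 / 2 + \<tau> (Suc n) * \<delta> * ?a"
    using dual_error_step[of n] by (simp add: mult.assoc)
  moreover have "?a\<^sup>2 / 2 + (?a - ?b)\<^sup>2 / 2 - ?b\<^sup>2 / 2 = ?a * (?a - ?b)"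
    by (simp add: power2_eq_square field_simps)
  ultimately have "?a * (?a - ?b) \<le> ?a * (\<tau> (Suc n) * \<delta>)"
    by (simp add: mult.commute)
  moreover have "0 < ?a" using ab by (smt (verit) norm_ge_zero)
  ultimately show False using * by simp
qed

lemma dual_error_le: "dual_error n \<le> dual_error 0 + elapsed n * \<delta>"
proof (induction n)
  case (Suc n)
  then show ?case using dual_error_Suc_le[of n] by (simp add: elapsed_Suc algebra_simps)
qed (simp add: elapsed_def)

text \<open>The subgradient inequality at u_n tested with the next iterate leaves only -\<tau> <y -
  w, g - w>, whose main part is the squared residual. The starting element p_0 is arbitrary and
  carries no such inequality, hence n \<ge> 1.\<close>

lemma bregman_step:
  assumes "n \<ge> 1"
  shows "bregman (Suc n) + \<tau> (Suc n) * (norm (w (Suc n) - y) * (norm (w (Suc n) - y) - \<delta>))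
    \<le> bregman n"
proof -
  let ?t = "\<tau> (Suc n)" and ?w = "w (Suc n)" and ?r = "norm (w (Suc n) - y)"
  have p: "p (Suc n) = p n + ?t *\<^sub>R (y - ?w)" using update[of "Suc n"] by simp
  have "bregman (Suc n) - bregman n
      = j n - j (Suc n) + p n \<bullet> (g - w n) - p (Suc n) \<bullet> (g - ?w)"
    by (simp add: bregman_def)
  also have "\<dots> \<le> p n \<bullet> (g - w n) - p n \<bullet> (?w - w n) - p (Suc n) \<bullet> (g - ?w)"
    using subgrad[of n "Suc n"] assms by simp
  also have "\<dots> = - ?t * ((y - ?w) \<bullet> (g - ?w))"
    unfolding p by (simp add: inner_diff inner_add_left algebra_simps)
  also have "(y - ?w) \<bullet> (g - ?w) = ?r\<^sup>2 - (?w - y) \<bullet> (g - y)"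
    unfolding power2_norm_eq_inner by (simp add: inner_diff inner_commute algebra_simps)
  finally have *: "bregman (Suc n) - bregman n \<le> - ?t * (?r\<^sup>2 - (?w - y) \<bullet> (g - y))" .
  have "(?w - y) \<bullet> (g - y) \<le> ?r * \<delta>"
    using norm_cauchy_schwarz[of "?w - y" "g - y"] noise_level
    by (metis mult_left_mono norm_ge_zero norm_minus_commute order_trans)
  then have "?t * (?r * (?r - \<delta>)) \<le> ?t * (?r\<^sup>2 - (?w - y) \<bullet> (g - y))"
    using step_pos[of "Suc n"] by (intro mult_left_mono) (auto simp: power2_eq_square algebra_simps)
  with * show ?thesis by simp
qed

section \<open>The iteration before the discrepancy principle stops\<close>

context
  fixes \<rho> :: real and N :: nat
  assumes rho: "1 < \<rho>"
    and large_residual: "\<And>k. 1 \<le> k \<Longrightarrow> k \<le> N \<Longrightarrow> \<rho> * \<delta> \<le> norm (w k - y)"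
begin

text \<open>For a residual r \<ge> \<rho> \<delta> the gain r (r - \<delta>) of
  \<open>bregman_step\<close> is at least \<rho> (\<rho> - 1) \<delta>^2.\<close>

lemma bregman_decrease:
  assumes "1 \<le> n" "Suc n \<le> N"
  shows "bregman (Suc n) + \<tau> (Suc n) * (\<rho> * (\<rho> - 1) * \<delta>\<^sup>2) \<le> bregman n"
proof -
  let ?r = "norm (w (Suc n) - y)"
  have r: "\<rho> * \<delta> \<le> ?r" using large_residual[of "Suc n"] assms by simp
  have "\<rho> * (\<rho> - 1) * \<delta>\<^sup>2 = (\<rho> * \<delta>) * (\<rho> * \<delta> - \<delta>)"
    by (simp add: power2_eq_square algebra_simps)
  also have "\<dots> \<le> ?r * (?r - \<delta>)"
    using r rho noise_level_nonneg mult_right_mono[of 1 \<rho> \<delta>] by (intro mult_mono) auto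
  finally have "\<tau> (Suc n) * (\<rho> * (\<rho> - 1) * \<delta>\<^sup>2) \<le> \<tau> (Suc n) * (?r * (?r - \<delta>))"
    using step_pos[of "Suc n"] by (intro mult_left_mono) auto
  then show ?thesis using bregman_step[OF assms(1)] by linarith
qed

lemma bregman_decay:
  assumes "1 \<le> m" "m \<le> n" "n \<le> N"
  shows "bregman n + (elapsed n - elapsed m) * (\<rho> * (\<rho> - 1) * \<delta>\<^sup>2) \<le> bregman m"
  using assms(2,3)
proof (induction n rule: dec_induct)
  case (step n)
  then show ?case
    using bregman_decrease[of n] assms(1) by (simp add: elapsed_Suc algebra_simps)
qed simp

text \<open>The left-hand side is the Lyapunov function of the proximal point method. Without noise
  it would not increase; the noise contributes at most \<tau>_k \<delta> (a + t_k \<delta>) at step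
  k, with a the initial dual error.\<close>

lemma elapsed_bregman_le:
  assumes "n \<le> N"
  shows "elapsed n * bregman n + (dual_error n)\<^sup>2 / 2
    \<le> (dual_error 0)\<^sup>2 / 2 + elapsed n * \<delta> * (dual_error 0 + elapsed n * \<delta>)"
  using assms
proof (induction n)
  case 0
  then show ?case by (simp add: elapsed_def)
next
  case (Suc n)
  let ?T = "elapsed n" and ?t = "\<tau> (Suc n)" and ?a = "dual_error 0"
  have t: "0 < ?t" by (simp add: step_pos)
  have "?T * bregman (Suc n) \<le> ?T * bregman n"
  \<comment> \<open>Monotonicity of the Bregman distance starts only at index 1, but at n = 0 the
    factor \<open>elapsed 0\<close> vanishes.\<close>
  proof (cases "n = 0")
    case False
    then have "bregman (Suc n) \<le> bregman n"
      using bregman_decay[of n "Suc n"] Suc.prems rho t by (simp add: elapsed_Suc)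
        (smt (verit) mult_nonneg_nonneg zero_le_power2)
    then show ?thesis using elapsed_nonneg by (rule mult_left_mono)
  qed (simp add: elapsed_def)
  moreover have "?t * bregman (Suc n) + (dual_error (Suc n))\<^sup>2 / 2
      \<le> (dual_error n)\<^sup>2 / 2 + ?t * (\<delta> * dual_error (Suc n))"
    using dual_error_step[of n] by (smt (verit) zero_le_power2 divide_nonneg_pos)
  moreover have "?t * (\<delta> * dual_error (Suc n)) \<le> ?t * (\<delta> * (?a + elapsed (Suc n) * \<delta>))"
    using dual_error_le[of "Suc n"] t noise_level_nonneg by (intro mult_left_mono) auto
  \<comment> \<open>The inner time of the old bound is raised to the new one, so that it adds up
    with the noise term of the new step.\<close>
  moreover have "?T * \<delta> * (?a + ?T * \<delta>) \<le> ?T * \<delta> * (?a + elapsed (Suc n) * \<delta>)"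
    using elapsed_mono[of n "Suc n"] elapsed_nonneg[of n] noise_level_nonneg
    by (intro mult_left_mono add_left_mono mult_right_mono) auto
  ultimately show ?case using Suc.IH Suc.prems by (simp add: elapsed_Suc algebra_simps)
qed

text \<open>
  Up to the time \<open>1 / \<delta>\<close> the Bregman distance drops to the order \<open>\<delta>\<close>; from then on it
  loses at least a multiple of \<open>\<delta>\<^sup>2\<close> per unit of time as long as the residual is large.
\<close>

lemma elapsed_le:
  assumes delta: "0 < \<delta>" and T: "\<And>k. k \<ge> 1 \<Longrightarrow> \<tau> k \<le> T"
  shows "elapsed N * \<delta> \<le> 1 + T * \<delta> +
    ((dual_error 0)\<^sup>2 / 2 + dual_error 0 + 1 + T * \<delta>) / (\<rho> * (\<rho> - 1))"
proof -
  let ?a = "dual_error 0" and ?c = "\<rho> * (\<rho> - 1)"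
  have c: "0 < ?c" using rho by simp
  have T0: "0 \<le> T" using T[of 1] step_pos[of 1] by simp
  show ?thesis
  proof (cases "1 \<le> elapsed N * \<delta>")
    case False
    have "0 \<le> (?a\<^sup>2 / 2 + ?a + 1 + T * \<delta>) / ?c" using c T0 delta by simp
    moreover have "0 \<le> T * \<delta>" using T0 delta by simp
    ultimately show ?thesis using False by linarith
  next
    case True
    \<comment> \<open>The first index with t_m \<ge> 1 / \<delta>. One step adds at most T, so the
      rescaled time s lies between 1 and 1 + T \<delta>.\<close>
    define m where "m = (LEAST n. 1 \<le> elapsed n * \<delta>)"
    have m: "1 \<le> elapsed m * \<delta>" unfolding m_def using True by (rule LeastI)
    have mN: "m \<le> N" unfolding m_def using True by (rule Least_le)
    have m1: "1 \<le> m" using m by (cases m) (auto simp: elapsed_def)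
    then obtain l where l: "m = Suc l" by (cases m) auto
    define s where "s = elapsed m * \<delta>"
    have "elapsed l * \<delta> < 1"
      using not_less_Least[of l "\<lambda>n. 1 \<le> elapsed n * \<delta>"] l m_def by simp
    moreover have "\<tau> m * \<delta> \<le> T * \<delta>" using T m1 delta by simp
    ultimately have s: "1 \<le> s" "s \<le> 1 + T * \<delta>"
      using m by (simp_all add: s_def l elapsed_Suc algebra_simps)
    have "elapsed m * bregman m \<le> ?a\<^sup>2 / 2 + s * (?a + s)"
      using elapsed_bregman_le[OF mN] unfolding s_def by (smt (verit) zero_le_power2 divide_nonneg_pos)
    then have "s * bregman m \<le> \<delta> * (?a\<^sup>2 / 2 + s * (?a + s))"
      using delta by (simp add: s_def mult.commute mult.left_commute)
    \<comment> \<open>Since s \<ge> 1, the term a^2 / 2 is at most s a^2 / 2; then s cancels and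
      \<open>bregman m\<close> is of order \<delta>.\<close>
    also have "\<dots> \<le> \<delta> * (s * (?a\<^sup>2 / 2 + ?a + s))"
      using delta s mult_right_mono[of 1 s "?a\<^sup>2 / 2"] by (simp add: algebra_simps)
    finally have "s * bregman m \<le> s * (\<delta> * (?a\<^sup>2 / 2 + ?a + s))"
      by (simp add: mult.left_commute)
    then have "bregman m \<le> \<delta> * (?a\<^sup>2 / 2 + ?a + s)" using s by simp
    moreover have "(elapsed N - elapsed m) * (?c * \<delta>\<^sup>2) \<le> bregman m"
      using bregman_decay[OF m1 mN order_refl] bregman_nonneg[of N] m1 mN by simp
    ultimately have "\<delta> * ((elapsed N * \<delta> - s) * ?c) \<le> \<delta> * (?a\<^sup>2 / 2 + ?a + s)"
      by (simp add: s_def power2_eq_square algebra_simps)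
    then have "(elapsed N * \<delta> - s) * ?c \<le> ?a\<^sup>2 / 2 + ?a + s"
      using delta by simp
    then have "elapsed N * \<delta> - s \<le> (?a\<^sup>2 / 2 + ?a + s) / ?c"
      using c by (simp add: pos_le_divide_eq)
    also have "\<dots> \<le> (?a\<^sup>2 / 2 + ?a + 1 + T * \<delta>) / ?c"
      using c s by (intro divide_right_mono) auto
    finally show ?thesis using s by linarith
  qed
qed

end

text \<open>If the rule never stopped, \<open>elapsed_le\<close> would bound all t_N. Otherwise that
  bound applies to the predecessor of n, and the last step adds another T \<delta>, hence the factor
  2.\<close>

lemma discrepancy_principle:
  fixes \<rho> T :: real
  defines "n \<equiv> LEAST n. n \<ge> 1 \<and> norm (w n - y) < \<rho> * \<delta>"
  assumes rho: "1 < \<rho>" and delta: "0 < \<delta>"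
    and T: "\<And>k. k \<ge> 1 \<Longrightarrow> \<tau> k \<le> T"
    and unbounded: "filterlim elapsed at_top sequentially"
  shows "1 \<le> n" "norm (w n - y) < \<rho> * \<delta>"
    and "elapsed n * \<delta> \<le> 1 + 2 * T * \<delta> +
      ((dual_error 0)\<^sup>2 / 2 + dual_error 0 + 1 + T * \<delta>) / (\<rho> * (\<rho> - 1))"
proof -
  let ?stop = "\<lambda>n. n \<ge> 1 \<and> norm (w n - y) < \<rho> * \<delta>"
  let ?B = "1 + T * \<delta> +
    ((dual_error 0)\<^sup>2 / 2 + dual_error 0 + 1 + T * \<delta>) / (\<rho> * (\<rho> - 1))"
  have le: "elapsed N * \<delta> \<le> ?B" if "\<And>k. k \<le> N \<Longrightarrow> \<not> ?stop k" for N
    using that by (intro elapsed_le rho delta T) (auto simp: not_less)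
  have "\<exists>n. ?stop n"
  proof (rule ccontr)
    assume never: "\<nexists>n. ?stop n"
    obtain N where N: "?B / \<delta> < elapsed N"
      using unbounded unfolding filterlim_at_top_dense eventually_sequentially by blast
    then have "?B < elapsed N * \<delta>" using delta by (simp only: pos_divide_less_eq)
    then show False using le[of N] never by auto
  qed
  then have stop: "?stop n" unfolding n_def by (rule LeastI_ex)
  then show "1 \<le> n" "norm (w n - y) < \<rho> * \<delta>" by simp_all
  then obtain l where l: "n = Suc l" by (cases n) auto
  have "elapsed l * \<delta> \<le> ?B"
  proof (rule le)
    fix k assume "k \<le> l"
    then have "k < n" by (simp add: l)
    then show "\<not> ?stop k" unfolding n_def by (rule not_less_Least)
  qed
  moreover have "\<tau> n * \<delta> \<le> T * \<delta>" using T[of n] l delta by simp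
  moreover have "elapsed n * \<delta> = elapsed l * \<delta> + \<tau> n * \<delta>"
    by (simp add: l elapsed_Suc distrib_right)
  ultimately show "elapsed n * \<delta> \<le> 1 + 2 * T * \<delta> +
      ((dual_error 0)\<^sup>2 / 2 + dual_error 0 + 1 + T * \<delta>) / (\<rho> * (\<rho> - 1))"
    by linarith
qed

end

section \<open>The scalar function \<open>\<bar>x\<bar> powr q\<close>\<close>

definition powr_deriv :: "real \<Rightarrow> real \<Rightarrow> real"
  where "powr_deriv q a = q * (sgn a * \<bar>a\<bar> powr (q - 1))"

lemma DERIV_abs_powr:
  fixes a q :: real
  assumes "1 < q"
  shows "((\<lambda>x. \<bar>x\<bar> powr q) has_real_derivative powr_deriv q a) (at a)"
proof (cases a "0::real" rule: linorder_cases)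
  case greater
  have "((\<lambda>x. x powr q) has_real_derivative powr_deriv q a) (at a)"
    using greater by (auto intro!: derivative_eq_intros simp: powr_deriv_def)
  moreover have "\<forall>\<^sub>F x in nhds a. \<bar>x\<bar> powr q = x powr q"
    using eventually_nhds_in_open[of "{0<..}" a] greater by (auto elim!: eventually_mono)
  ultimately show ?thesis by (subst DERIV_cong_ev[OF refl _ refl])
next
  case less
  have "((\<lambda>x. (- x) powr q) has_real_derivative powr_deriv q a) (at a)"
    using less by (auto intro!: derivative_eq_intros simp: powr_deriv_def)
  moreover have "\<forall>\<^sub>F x in nhds a. \<bar>x\<bar> powr q = (- x) powr q"
    using eventually_nhds_in_open[of "{..<0}" a] less by (auto elim!: eventually_mono)
  ultimately show ?thesis by (subst DERIV_cong_ev[OF refl _ refl])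
next
  case equal
  have "((\<lambda>h. \<bar>h\<bar> powr (q - 1)) \<longlongrightarrow> 0) (at 0)"
    using assms by (auto intro!: tendsto_eq_intros)
  then have "((\<lambda>h. sgn h * \<bar>h\<bar> powr (q - 1)) \<longlongrightarrow> 0) (at (0::real))"
    by (rule tendsto_rabs_zero_cancel[OF Lim_transform_eventually])
      (auto simp: abs_mult eventually_at_filter abs_sgn_eq)
  moreover have "\<bar>h\<bar> powr q / h = sgn h * \<bar>h\<bar> powr (q - 1)" if "h \<noteq> 0" for h :: real
    using that by (simp add: powr_diff sgn_real_def)
  ultimately have "((\<lambda>h. \<bar>h\<bar> powr q / h) \<longlongrightarrow> 0) (at (0::real))"
    by (simp cong: LIM_cong)
  then show ?thesis using assms by (simp add: equal DERIV_def powr_deriv_def)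
qed

text \<open>Subtracting the affine minorant from |x|^q leaves a function with a minimum at a, where
  the derivative vanishes.\<close>

lemma abs_powr_subgradient_eq:
  fixes a \<xi> q :: real
  assumes "1 < q" and sub: "\<And>x. \<bar>a\<bar> powr q + \<xi> * (x - a) \<le> \<bar>x\<bar> powr q"
  shows "\<xi> = powr_deriv q a"
proof -
  have "((\<lambda>x. \<xi> * (x - a)) has_real_derivative \<xi>) (at a)"
    by (auto intro!: derivative_eq_intros)
  from DERIV_diff[OF DERIV_abs_powr[OF assms(1)] this]
  have "powr_deriv q a - \<xi> = 0"
  proof (rule DERIV_local_min[where d = 1])
    show "\<forall>x. \<bar>a - x\<bar> < 1 \<longrightarrow>
        \<bar>a\<bar> powr q - \<xi> * (a - a) \<le> \<bar>x\<bar> powr q - \<xi> * (x - a)"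
      using sub by (auto simp: algebra_simps)
  qed simp
  then show ?thesis by simp
qed

section \<open>Convexity and subadditivity of powers\<close>

lemma powr_convex_combination:
  fixes x y s t q :: real
  assumes "1 \<le> q" "0 \<le> s" "0 \<le> t" "s + t = 1" "0 \<le> x" "0 \<le> y"
  shows "(s * x + t * y) powr q \<le> s * x powr q + t * y powr q"
proof -
  \<comment> \<open>Settles the cases in which x or y is 0 and only one term remains.\<close>
  have le: "c powr q \<le> c" if "0 \<le> c" "c \<le> 1" for c :: real
    using powr_mono'[of 1 q c] that assms(1) by simp
  consider "x = 0" | "y = 0" | "0 < x" "0 < y" using assms by force
  then show ?thesis
  proof cases
    case 1
    then show ?thesis using assms le[of t] by (simp add: powr_mult mult_right_mono)
  next
    case 2
    then show ?thesis using assms le[of s] by (simp add: powr_mult mult_right_mono)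
  next
    case 3
    then show ?thesis
      using powr_convex[OF assms(1)] assms unfolding convex_on_def by simp
  qed
qed

lemma abs_powr_convex_combination:
  fixes x y s t q :: real
  assumes "1 \<le> q" "0 \<le> s" "0 \<le> t" "s + t = 1"
  shows "\<bar>s * x + t * y\<bar> powr q \<le> s * \<bar>x\<bar> powr q + t * \<bar>y\<bar> powr q"
proof -
  have "\<bar>s * x + t * y\<bar> \<le> s * \<bar>x\<bar> + t * \<bar>y\<bar>"
    using abs_triangle_ineq[of "s * x" "t * y"] assms by (simp add: abs_mult)
  then have "\<bar>s * x + t * y\<bar> powr q \<le> (s * \<bar>x\<bar> + t * \<bar>y\<bar>) powr q"
    using assms by (intro powr_mono2) auto
  also have "\<dots> \<le> s * \<bar>x\<bar> powr q + t * \<bar>y\<bar> powr q"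
    by (rule powr_convex_combination) (use assms in auto)
  finally show ?thesis .
qed

text \<open>The fractions x / (x + y) and y / (x + y) lie in [0, 1], so each is at most its s-th
  power, and they add up to 1.\<close>

lemma powr_subadditive:
  fixes x y s :: real
  assumes "0 < s" "s \<le> 1" "0 \<le> x" "0 \<le> y"
  shows "(x + y) powr s \<le> x powr s + y powr s"
proof (cases "x + y = 0")
  case False
  then have z: "0 < x + y" using assms by simp
  have *: "c / (x + y) \<le> (c / (x + y)) powr s" if "0 \<le> c" "c \<le> x + y" for c
    using powr_mono'[of s 1 "c / (x + y)"] assms z that by simp
  have "1 = x / (x + y) + y / (x + y)" using z by (simp flip: add_divide_distrib)
  also have "\<dots> \<le> (x / (x + y)) powr s + (y / (x + y)) powr s"
    using assms by (intro add_mono *) auto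
  also have "\<dots> = (x powr s + y powr s) / (x + y) powr s"
    by (simp add: powr_divide add_divide_distrib)
  finally show ?thesis using z by (simp add: pos_le_divide_eq)
qed (use assms in auto)

text \<open>\<open>powr_deriv\<close> is odd, so the estimates below survive an exchange of a and b
  and a common change of sign. Up to these symmetries two sign patterns remain.\<close>

lemma real_pair_sign_cases [case_names swap neg same opposite]:
  fixes P :: "real \<Rightarrow> real \<Rightarrow> bool"
  assumes swap: "\<And>a b. P a b \<Longrightarrow> P b a"
    and neg: "\<And>a b. P a b \<Longrightarrow> P (- a) (- b)"
    and same: "\<And>a b. 0 \<le> b \<Longrightarrow> b \<le> a \<Longrightarrow> P a b"
    and opposite: "\<And>a b. 0 < a \<Longrightarrow> 0 < b \<Longrightarrow> P a (- b)"
  shows "P a b"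
proof -
  have *: "P a b" if "0 \<le> a" "0 \<le> b" for a b
    using that same[of b a] same[of a b] swap by (cases "b \<le> a") auto
  have **: "P a b" if "0 \<le> a" for a b
  proof (cases "0 \<le> b \<or> a = 0")
    case True
    then show ?thesis using that *[of a b] neg[OF *[of "- a" "- b"]] by fastforce
  next
    case False
    then show ?thesis using that opposite[of a "- b"] by simp
  qed
  show ?thesis using **[of a b] neg[OF **[of "- a" "- b"]] by fastforce
qed

section \<open>Continuity and monotonicity of the derivative\<close>

lemma powr_deriv_minus: "powr_deriv q (- a) = - powr_deriv q a"
  by (simp add: powr_deriv_def sgn_minus)

lemma powr_deriv_pos: "0 \<le> a \<Longrightarrow> powr_deriv q a = q * a powr (q - 1)"
  by (cases "a = 0") (simp_all add: powr_deriv_def)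

text \<open>For equal signs this is subadditivity of the power q - 1 \<le> 1. For opposite signs
  each of the two terms is at most (a + b)^(q - 1), which explains the factor 2.\<close>

lemma powr_deriv_hoelder:
  assumes q: "1 < q" "q \<le> 2"
  shows "\<bar>powr_deriv q a - powr_deriv q b\<bar> \<le> 2 * q * \<bar>a - b\<bar> powr (q - 1)"
proof (induction a b rule: real_pair_sign_cases)
  case (swap a b)
  then show ?case by (simp add: abs_minus_commute)
next
  case (neg a b)
  then show ?case unfolding powr_deriv_minus by (simp add: abs_minus_commute)
next
  case (same a b)
  have "a powr (q - 1) - b powr (q - 1) \<le> (a - b) powr (q - 1)"
    using powr_subadditive[of "q - 1" "a - b" b] same q by simp
  moreover have "b powr (q - 1) \<le> a powr (q - 1)"
    using same q by (intro powr_mono2) auto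
  ultimately have "\<bar>a powr (q - 1) - b powr (q - 1)\<bar> \<le> 2 * (a - b) powr (q - 1)"
    by simp
  then have "q * \<bar>a powr (q - 1) - b powr (q - 1)\<bar> \<le> q * (2 * (a - b) powr (q - 1))"
    using q by (intro mult_left_mono) auto
  then show ?case
    using same q by (simp add: powr_deriv_pos abs_mult flip: right_diff_distrib)
next
  case (opposite a b)
  have "a powr (q - 1) \<le> (a + b) powr (q - 1)" "b powr (q - 1) \<le> (a + b) powr (q - 1)"
    using opposite q by (auto intro!: powr_mono2)
  then have "q * (a powr (q - 1) + b powr (q - 1)) \<le> q * (2 * (a + b) powr (q - 1))"
    using q by (intro mult_left_mono) auto
  then show ?case
    using opposite q by (simp add: powr_deriv_minus powr_deriv_pos algebra_simps)
qed

lemma powr_deriv_mono_gap_nonneg: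
  assumes "1 < q"
  shows "0 \<le> (powr_deriv q a - powr_deriv q b) * (a - b)"
proof (induction a b rule: real_pair_sign_cases)
  case (swap a b)
  then show ?case by (simp add: algebra_simps)
next
  case (neg a b)
  then show ?case by (simp add: powr_deriv_minus algebra_simps)
next
  case (same a b)
  then have "b powr (q - 1) \<le> a powr (q - 1)" using assms by (intro powr_mono2) auto
  then show ?case using same assms by (simp add: powr_deriv_pos)
next
  case (opposite a b)
  then show ?case using assms by (simp add: powr_deriv_minus powr_deriv_pos)
qed

text \<open>Since r - 1 = 1 / (q - 1), the power r - 1 of the Hoelder bound is linear in |a - b|.
  Multiplication by the difference of derivatives gives the scalar estimate behind the dual
  rate.\<close>

lemma powr_deriv_cocoercive:
  assumes q: "1 < q" "q \<le> 2" and r: "r = q / (q - 1)"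
  shows "\<bar>powr_deriv q a - powr_deriv q b\<bar> powr r
    \<le> (2 * q) powr (r - 1) * ((powr_deriv q a - powr_deriv q b) * (a - b))"
proof -
  let ?d = "\<bar>powr_deriv q a - powr_deriv q b\<bar>"
  have r1: "r - 1 = 1 / (q - 1)" using q by (simp add: r field_simps)
  have "?d powr (r - 1) \<le> (2 * q * \<bar>a - b\<bar> powr (q - 1)) powr (r - 1)"
    using powr_deriv_hoelder[OF q] q by (intro powr_mono2) (auto simp: r1)
  also have "\<dots> = (2 * q) powr (r - 1) * \<bar>a - b\<bar>"
    using q by (simp add: powr_mult powr_powr r1)
  finally have "?d * ?d powr (r - 1) \<le> ?d * ((2 * q) powr (r - 1) * \<bar>a - b\<bar>)"
    by (intro mult_left_mono) auto
  moreover have "?d * ?d powr (r - 1) = ?d powr r"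
    by (simp add: powr_mult_base)
  moreover have "?d * \<bar>a - b\<bar> = (powr_deriv q a - powr_deriv q b) * (a - b)"
    using powr_deriv_mono_gap_nonneg[OF q(1)] by (simp flip: abs_mult)
  ultimately show ?thesis by (metis mult.left_commute)
qed

text \<open>The mean value point lies below a, and the derivative does not increase.
  Differentiability is needed only inside the interval, so b = 0 is allowed.\<close>

lemma powr_concave_tangent:
  fixes a b s :: real
  assumes "0 < s" "s \<le> 1" "0 \<le> b" "b \<le> a" "0 < a"
  shows "s * a powr (s - 1) * (a - b) \<le> a powr s - b powr s"
proof (cases "b = a")
  case False
  then have ba: "b < a" using assms by simp
  obtain l z where z: "b < z" "z < a" and l: "DERIV (\<lambda>x. x powr s) z :> l"
    and eq: "a powr s - b powr s = (a - b) * l"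
  proof (rule exE[OF MVT[OF ba]])
    show "continuous_on {b..a} (\<lambda>x. x powr s)"
      using assms by (auto intro!: continuous_intros continuous_on_powr')
    show "(\<lambda>x. x powr s) differentiable at x" if "b < x" "x < a" for x
      using that assms has_real_derivative_powr[of x s] real_differentiable_def by force
  qed blast
  have "l = s * z powr (s - 1)"
    using DERIV_unique[OF l has_real_derivative_powr[of z s]] z assms by simp
  moreover have "a powr (s - 1) \<le> z powr (s - 1)"
    using z assms by (intro powr_mono2') auto
  ultimately have "s * a powr (s - 1) * (a - b) \<le> l * (a - b)"
    using ba assms by (intro mult_right_mono mult_left_mono) auto
  then show ?thesis using eq by (simp add: mult.commute)
qed (use assms in auto)

text \<open>For equal signs the tangent bound at the larger argument applies, where the power q - 2
  \<le> 0 is smallest. For opposite signs a + b is at most twice the maximum, which the factor 1 / 2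
  compensates.\<close>

lemma powr_deriv_strong_mono:
  assumes q: "1 < q" "q \<le> 2"
  shows "(q - 1) / 2 * (a - b)\<^sup>2 * (max \<bar>a\<bar> \<bar>b\<bar>) powr (q - 2)
    \<le> (powr_deriv q a - powr_deriv q b) * (a - b)"
proof (induction a b rule: real_pair_sign_cases)
  case (swap a b)
  then show ?case by (simp add: power2_commute max.commute algebra_simps)
next
  case (neg a b)
  have "(- a - - b)\<^sup>2 = (a - b)\<^sup>2" by (simp add: power2_commute)
  then show ?case using neg by (simp add: powr_deriv_minus algebra_simps)
next
  case (same a b)
  show ?case
  proof (cases "a = 0")
    case False
    then have "(q - 1) * a powr (q - 1 - 1) * (a - b) \<le> a powr (q - 1) - b powr (q - 1)"
      using same q by (intro powr_concave_tangent) auto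
    moreover have "0 \<le> a powr (q - 1) - b powr (q - 1)"
      using same q by (auto intro!: powr_mono2)
    ultimately have "(q - 1) / 2 * a powr (q - 2) * (a - b) \<le> q * (a powr (q - 1) - b powr (q - 1))"
      using q mult_right_mono[of 1 q "a powr (q - 1) - b powr (q - 1)"] by simp
    then have "(q - 1) / 2 * a powr (q - 2) * (a - b) * (a - b)
        \<le> q * (a powr (q - 1) - b powr (q - 1)) * (a - b)"
      using same by (intro mult_right_mono) auto
    moreover have "(q - 1) / 2 * a powr (q - 2) * (a - b) * (a - b)
        = (q - 1) / 2 * (a - b)\<^sup>2 * (max \<bar>a\<bar> \<bar>b\<bar>) powr (q - 2)"
      using same by (simp add: power2_eq_square max_absorb1)
    moreover have "q * (a powr (q - 1) - b powr (q - 1)) = powr_deriv q a - powr_deriv q b"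
      using same by (simp add: powr_deriv_pos algebra_simps)
    ultimately show ?thesis by (simp only:)
  qed (use same in simp)
next
  case (opposite a b)
  let ?M = "max a b"
  have M: "0 < ?M" "a \<le> ?M" "b \<le> ?M" using opposite by auto
  have "(q - 1) / 2 * (a + b) * ?M powr (q - 2) \<le> 1 / 2 * (2 * ?M) * ?M powr (q - 2)"
    using M q opposite by (intro mult_right_mono mult_mono) auto
  also have "\<dots> = ?M powr (q - 1)"
    using M by (simp add: powr_mult_base)
  also have "\<dots> \<le> a powr (q - 1) + b powr (q - 1)"
    by (simp add: max_def)
  also have "\<dots> \<le> q * (a powr (q - 1) + b powr (q - 1))"
    using q mult_right_mono[of 1 q "a powr (q - 1) + b powr (q - 1)"] by simp
  finally have "(q - 1) / 2 * (a + b) * ?M powr (q - 2) * (a + b)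
      \<le> q * (a powr (q - 1) + b powr (q - 1)) * (a + b)"
    using opposite by (intro mult_right_mono) auto
  moreover have "(q - 1) / 2 * (a + b) * ?M powr (q - 2) * (a + b)
      = (q - 1) / 2 * (a - - b)\<^sup>2 * (max \<bar>a\<bar> \<bar>- b\<bar>) powr (q - 2)"
    using opposite by (simp add: power2_eq_square)
  moreover have "q * (a powr (q - 1) + b powr (q - 1)) = powr_deriv q a - powr_deriv q (- b)"
    using opposite by (simp add: powr_deriv_minus powr_deriv_pos algebra_simps)
  ultimately show ?case by (simp only: diff_minus_eq_add)
qed

text \<open>Both bases are at most x + y and the exponents add up to 1: Young's inequality with its
  weights dropped.\<close>

lemma powr_interpolate:
  fixes x y \<theta> :: real
  assumes "0 \<le> x" "0 \<le> y" "0 \<le> \<theta>" "\<theta> \<le> 1"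
  shows "x powr \<theta> * y powr (1 - \<theta>) \<le> x + y"
proof -
  have "x powr \<theta> * y powr (1 - \<theta>) \<le> (x + y) powr \<theta> * (x + y) powr (1 - \<theta>)"
    using assms by (intro mult_mono powr_mono2) auto
  also have "\<dots> = x + y" using assms by (simp flip: powr_add)
  finally show ?thesis .
qed

text \<open>
  The weighted Young inequality with weight \<open>t\<close> replaces Hoelder's inequality for the
  exponents \<open>2 / q\<close> and \<open>2 / (2 - q)\<close>, so that the estimate can be summed termwise.
\<close>

lemma abs_diff_powr_le:
  assumes q: "1 < q" "q \<le> 2" and t: "0 < t"
  shows "\<bar>a - b\<bar> powr q \<le> t powr (q / 2) *
    (2 / (q - 1) * ((powr_deriv q a - powr_deriv q b) * (a - b)) / t + \<bar>a\<bar> powr q + \<bar>b\<bar> powr q)"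
proof (cases "a = b")
  case True
  then show ?thesis by simp
next
  case False
  let ?M = "max \<bar>a\<bar> \<bar>b\<bar>" and ?S = "(powr_deriv q a - powr_deriv q b) * (a - b)"
  have M: "0 < ?M" using False by auto
  \<comment> \<open>The quantity controlled by \<open>powr_deriv_strong_mono\<close>. In x^(q/2)
    (M^q)^(1 - q/2) the powers of M cancel, leaving |a - b|^q.\<close>
  define x where "x = \<bar>a - b\<bar> powr 2 * ?M powr (q - 2)"
  have x: "0 \<le> x" by (simp add: x_def)
  have "(q - 1) / 2 * x \<le> ?S"
    using powr_deriv_strong_mono[OF q, of a b] False by (simp add: x_def mult.assoc)
  then have "x \<le> 2 / (q - 1) * ?S" using q by (simp add: field_simps)
  then have xS: "x / t \<le> 2 / (q - 1) * ?S / t" using t by (intro divide_right_mono) auto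
  have "\<bar>a - b\<bar> powr q = x powr (q / 2) * (?M powr q) powr (1 - q / 2)"
  proof -
    have "(\<bar>a - b\<bar> powr 2) powr (q / 2) = \<bar>a - b\<bar> powr q"
      unfolding powr_powr by simp
    moreover have "(?M powr (q - 2)) powr (q / 2) * (?M powr q) powr (1 - q / 2) = 1"
    proof -
      have "(q - 2) * (q / 2) + q * (1 - q / 2) = 0" by (simp add: field_simps)
      then show ?thesis unfolding powr_powr powr_add[symmetric] using M by simp
    qed
    ultimately show ?thesis by (simp add: x_def powr_mult mult.assoc)
  qed
  also have "\<dots> = t powr (q / 2) * ((x / t) powr (q / 2) * (?M powr q) powr (1 - q / 2))"
    using t by (simp add: powr_divide)
  also have "\<dots> \<le> t powr (q / 2) * (x / t + ?M powr q)"
    using x t q by (intro mult_left_mono powr_interpolate) auto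
  also have "\<dots> \<le> t powr (q / 2) * (2 / (q - 1) * ?S / t + (\<bar>a\<bar> powr q + \<bar>b\<bar> powr q))"
    using xS by (intro mult_left_mono add_mono) (auto simp: max_def)
  finally show ?thesis by (simp add: add.assoc)
qed

section \<open>Riesz representation in the sequence space\<close>

definition l2_unit :: "nat \<Rightarrow> l2"
  where "l2_unit k = Abs_l2 (\<lambda>j. if j = k then 1 else 0)"

lemma l2_nth_unit: "l2_nth (l2_unit k) j = (if j = k then 1 else 0)"
proof -
  have "summable (\<lambda>j. (if j = k then 1 else 0 :: real)\<^sup>2)"
    by (rule summable_finite[of "{k}"]) auto
  then show ?thesis by (simp add: l2_unit_def Abs_l2_inverse)
qed

lemma inner_l2_unit: "x \<bullet> l2_unit k = l2_nth x k"
proof -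
  have "x \<bullet> l2_unit k = (\<Sum>j\<in>{k}. l2_nth x j * l2_nth (l2_unit k) j)"
    unfolding inner_l2_eq by (rule suminf_finite) (auto simp: l2_nth_unit)
  then show ?thesis by (simp add: l2_nth_unit)
qed

lemma norm_l2_unit_combination:
  "(norm (\<Sum>k<m. c k *\<^sub>R l2_unit k))\<^sup>2 = (\<Sum>k<m. (c k)\<^sup>2)"
proof -
  let ?s = "\<Sum>k<m. c k *\<^sub>R l2_unit k"
  have "?s \<bullet> l2_unit i = c i" if "i < m" for i
  proof -
    have "?s \<bullet> l2_unit i = (\<Sum>k<m. if k = i then c i else 0)"
      unfolding inner_sum_left by (rule sum.cong) (simp_all add: inner_l2_unit l2_nth_unit scaleR_l2.rep_eq)
    then show ?thesis using that by simp
  qed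
  moreover have "v \<bullet> ?s = (\<Sum>i<m. c i * (v \<bullet> l2_unit i))" for v
    by (simp add: inner_sum_right)
  ultimately have "?s \<bullet> ?s = (\<Sum>i<m. (c i)\<^sup>2)"
    by (simp add: power2_eq_square)
  then show ?thesis by (simp add: power2_norm_eq_inner)
qed

text \<open>By orthonormality the squared error is the squared norm minus the partial sum of its
  series.\<close>

lemma l2_unit_partial_sums:
  "(\<lambda>m. \<Sum>k<m. l2_nth x k *\<^sub>R l2_unit k) \<longlonglongrightarrow> x"
proof -
  let ?s = "\<lambda>m. \<Sum>k<m. l2_nth x k *\<^sub>R l2_unit k"
  have "(norm (x - ?s m))\<^sup>2 = (norm x)\<^sup>2 - (\<Sum>k<m. (l2_nth x k)\<^sup>2)" for m
  proof -
    have "(norm (x - ?s m))\<^sup>2 = (norm x)\<^sup>2 - 2 * (x \<bullet> ?s m) + (norm (?s m))\<^sup>2"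
      unfolding power2_norm_eq_inner by (simp add: inner_diff inner_commute)
    moreover have "x \<bullet> ?s m = (\<Sum>k<m. (l2_nth x k)\<^sup>2)"
      by (simp add: inner_sum_right inner_l2_unit power2_eq_square)
    ultimately show ?thesis by (simp add: norm_l2_unit_combination)
  qed
  moreover have "(\<lambda>m. (norm x)\<^sup>2 - (\<Sum>k<m. (l2_nth x k)\<^sup>2)) \<longlonglongrightarrow> (norm x)\<^sup>2 - (norm x)\<^sup>2"
    unfolding norm_l2_square by (intro tendsto_intros summable_LIMSEQ summable_l2_nth)
  ultimately have "(\<lambda>m. (norm (x - ?s m))\<^sup>2) \<longlonglongrightarrow> 0" by simp
  then have "(\<lambda>m. sqrt ((norm (x - ?s m))\<^sup>2)) \<longlonglongrightarrow> sqrt 0" by (rule tendsto_real_sqrt)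
  then have "(\<lambda>m. norm (?s m - x)) \<longlonglongrightarrow> 0" by (simp add: norm_minus_commute)
  then show ?thesis using Lim_null tendsto_norm_zero_iff by blast
qed

text \<open>The representer has coefficients f(e_k). Testing f with their truncation v gives S = f v
  \<le> |v| B where |v|^2 = S, so S \<le> B^2 and the coefficients are square summable. Both sides
  then agree as limits along the unit vector expansion.\<close>

lemma l2_riesz_representation:
  assumes "bounded_linear (f :: l2 \<Rightarrow> real)"
  shows "\<exists>\<xi>. \<forall>x. f x = x \<bullet> \<xi>"
proof -
  interpret f: bounded_linear f by fact
  define c where "c k = f (l2_unit k)" for k
  obtain B where B: "\<And>x. norm (f x) \<le> norm x * B" using f.bounded by blast
  have f_sum: "f (\<Sum>k<m. x k *\<^sub>R l2_unit k) = (\<Sum>k<m. x k * c k)" for x m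
    by (simp add: f.sum f.scaleR c_def)
  have "(\<Sum>k<m. (c k)\<^sup>2) \<le> B\<^sup>2" for m
  proof -
    let ?v = "\<Sum>k<m. c k *\<^sub>R l2_unit k" and ?S = "\<Sum>k<m. (c k)\<^sup>2"
    have "?S = f ?v" unfolding f_sum by (simp add: power2_eq_square)
    then have "?S \<le> norm ?v * B" using B[of ?v] by simp
    then have "?S\<^sup>2 \<le> (norm ?v * B)\<^sup>2" by (intro power_mono) (auto intro: sum_nonneg)
    then have "?S * ?S \<le> ?S * B\<^sup>2"
      unfolding power_mult_distrib norm_l2_unit_combination power2_eq_square[of ?S] .
    moreover have "0 \<le> ?S" by (simp add: sum_nonneg)
    ultimately show ?thesis by (cases "?S = 0") (auto simp: mult_le_cancel_left)
  qed
  then have sc: "summable (\<lambda>k. (c k)\<^sup>2)"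
    by (intro summableI_nonneg_bounded[where x = "B\<^sup>2"]) auto
  have nth: "l2_nth (Abs_l2 c) = c" using sc by (simp add: Abs_l2_inverse)
  have "f x = x \<bullet> Abs_l2 c" for x
  proof (rule LIMSEQ_unique)
    show "(\<lambda>m. f (\<Sum>k<m. l2_nth x k *\<^sub>R l2_unit k)) \<longlonglongrightarrow> f x"
      by (intro f.tendsto l2_unit_partial_sums)
    show "(\<lambda>m. f (\<Sum>k<m. l2_nth x k *\<^sub>R l2_unit k)) \<longlonglongrightarrow> x \<bullet> Abs_l2 c"
      unfolding f_sum inner_l2_eq nth
      by (intro summable_LIMSEQ summable_square_mult summable_l2_nth sc)
  qed
  then show ?thesis by blast
qed

text \<open>\<open>adjoint\<close> is defined by choice, so its property rests on the existence of
  an adjoint, obtained by representing x -> <K x, z> for each z.\<close>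

lemma inner_adjoint_l2:
  fixes K :: "l2 \<Rightarrow> 'b::real_inner"
  assumes "bounded_linear K"
  shows "x \<bullet> adjoint K z = K x \<bullet> z"
proof -
  have "\<exists>\<xi>. \<forall>x. K x \<bullet> z = x \<bullet> \<xi>" for z
    by (intro l2_riesz_representation
        bounded_linear_compose[OF bounded_linear_inner_left assms])
  then obtain A where "\<forall>z x. K x \<bullet> z = x \<bullet> A z" by metis
  then have "\<exists>A. \<forall>x z. K x \<bullet> z = x \<bullet> A z" by blast
  then have "\<forall>x z. K x \<bullet> z = x \<bullet> adjoint K z"
    unfolding adjoint_def by (rule someI_ex)
  then show ?thesis by simp
qed

section \<open>Subgradients of the penalty\<close>

lemma lq_penalty_eq:
  "in_lp q (l2_nth u) \<Longrightarrow> lq_penalty q u = ereal (\<Sum>k. \<bar>l2_nth u k\<bar> powr q)"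
  by (simp add: lq_penalty_def)

lemma subdifferential_lq_penaltyD:
  assumes "\<xi> \<in> subdifferential (lq_penalty q) u"
  shows "in_lp q (l2_nth u)"
    and "in_lp q (l2_nth v) \<Longrightarrow>
      (\<Sum>k. \<bar>l2_nth u k\<bar> powr q) + \<xi> \<bullet> (v - u) \<le> (\<Sum>k. \<bar>l2_nth v k\<bar> powr q)"
proof -
  show u: "in_lp q (l2_nth u)"
    using assms by (auto simp: subdifferential_def lq_penalty_def split: if_splits)
  assume v: "in_lp q (l2_nth v)"
  have "lq_penalty q u + ereal (\<xi> \<bullet> (v - u)) \<le> lq_penalty q v"
    using assms by (auto simp: subdifferential_def)
  then show "(\<Sum>k. \<bar>l2_nth u k\<bar> powr q) + \<xi> \<bullet> (v - u) \<le> (\<Sum>k. \<bar>l2_nth v k\<bar> powr q)"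
    by (simp add: lq_penalty_eq u v)
qed

lemma subdifferential_lq_penaltyI:
  assumes "in_lp q (l2_nth u)"
    and "\<And>v. in_lp q (l2_nth v) \<Longrightarrow>
      (\<Sum>k. \<bar>l2_nth u k\<bar> powr q) + \<xi> \<bullet> (v - u) \<le> (\<Sum>k. \<bar>l2_nth v k\<bar> powr q)"
  shows "\<xi> \<in> subdifferential (lq_penalty q) u"
  using assms unfolding subdifferential_def by (auto simp: lq_penalty_def)

text \<open>Changing only coordinate k of u changes one term of the series, so
  \<open>l2_nth \<xi> k\<close> is a scalar subgradient.\<close>

lemma subdifferential_lq_penalty_nth:
  assumes q: "1 < q" and \<xi>: "\<xi> \<in> subdifferential (lq_penalty q) u"
  shows "l2_nth \<xi> k = powr_deriv q (l2_nth u k)"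
proof (rule abs_powr_subgradient_eq[OF q])
  fix x :: real
  define v where "v = u + (x - l2_nth u k) *\<^sub>R l2_unit k"
  have v: "l2_nth v i = (if i = k then x else l2_nth u i)" for i
    by (simp add: v_def plus_l2.rep_eq scaleR_l2.rep_eq l2_nth_unit)
  let ?d = "\<bar>x\<bar> powr q - \<bar>l2_nth u k\<bar> powr q"
  have "in_lp q (l2_nth u)" using \<xi> by (rule subdifferential_lq_penaltyD)
  then have "(\<lambda>i. \<bar>l2_nth u i\<bar> powr q + (if i = k then ?d else 0))
      sums ((\<Sum>i. \<bar>l2_nth u i\<bar> powr q) + ?d)"
    unfolding in_lp_def by (intro sums_add summable_sums sums_single)
  moreover have "\<bar>l2_nth u i\<bar> powr q + (if i = k then ?d else 0) = \<bar>l2_nth v i\<bar> powr q" for i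
    by (simp add: v)
  ultimately have sums: "(\<lambda>i. \<bar>l2_nth v i\<bar> powr q) sums ((\<Sum>i. \<bar>l2_nth u i\<bar> powr q) + ?d)"
    by simp
  then have "in_lp q (l2_nth v)" unfolding in_lp_def by (rule sums_summable)
  from subdifferential_lq_penaltyD(2)[OF \<xi> this] sums
  have "\<xi> \<bullet> (v - u) \<le> ?d" by (simp add: sums_iff)
  moreover have "\<xi> \<bullet> (v - u) = l2_nth \<xi> k * (x - l2_nth u k)"
    by (simp add: v_def inner_l2_unit mult.commute)
  ultimately show "\<bar>l2_nth u k\<bar> powr q + l2_nth \<xi> k * (x - l2_nth u k) \<le> \<bar>x\<bar> powr q" by simp
qed

lemma lq_penalty_convex_combination:
  assumes "1 \<le> q" "0 \<le> s" "0 \<le> t" "s + t = 1"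
    and u: "in_lp q (l2_nth u)" and v: "in_lp q (l2_nth v)"
  shows "in_lp q (l2_nth (s *\<^sub>R u + t *\<^sub>R v))"
    and "(\<Sum>k. \<bar>l2_nth (s *\<^sub>R u + t *\<^sub>R v) k\<bar> powr q)
      \<le> s * (\<Sum>k. \<bar>l2_nth u k\<bar> powr q) + t * (\<Sum>k. \<bar>l2_nth v k\<bar> powr q)"
proof -
  let ?f = "\<lambda>k. s * \<bar>l2_nth u k\<bar> powr q + t * \<bar>l2_nth v k\<bar> powr q"
  have le: "\<bar>l2_nth (s *\<^sub>R u + t *\<^sub>R v) k\<bar> powr q \<le> ?f k" for k
    using abs_powr_convex_combination[OF assms(1-4)]
    by (simp add: plus_l2.rep_eq scaleR_l2.rep_eq)
  have f: "?f sums (s * (\<Sum>k. \<bar>l2_nth u k\<bar> powr q) + t * (\<Sum>k. \<bar>l2_nth v k\<bar> powr q))"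
    using u v unfolding in_lp_def by (intro sums_add sums_mult summable_sums)
  show w: "in_lp q (l2_nth (s *\<^sub>R u + t *\<^sub>R v))"
    unfolding in_lp_def using le by (intro summable_comparison_test'[OF sums_summable[OF f]]) auto
  show "(\<Sum>k. \<bar>l2_nth (s *\<^sub>R u + t *\<^sub>R v) k\<bar> powr q)
      \<le> s * (\<Sum>k. \<bar>l2_nth u k\<bar> powr q) + t * (\<Sum>k. \<bar>l2_nth v k\<bar> powr q)"
    by (rule sums_le[OF le summable_sums f]) (use w in \<open>simp add: in_lp_def\<close>)
qed

text \<open>First-order optimality along the segment from u to v: J is convex and the quadratic term
  contributes only order s^2 beyond its linearization, so dividing by s and letting s tend to 0
  gives the subgradient inequality.\<close>

lemma aug_lagrangian_minimizer_subgradient: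
  fixes K :: "l2 \<Rightarrow> 'b::real_inner"
  assumes K: "bounded_linear K" and q: "1 < q"
    and min: "is_arg_min (aug_lagrangian K (lq_penalty q) t p y) (\<lambda>_. True) u"
  shows "adjoint K (p + t *\<^sub>R (y - K u)) \<in> subdifferential (lq_penalty q) u"
proof (rule subdifferential_lq_penaltyI)
  interpret K: bounded_linear K by fact
  let ?J = "\<lambda>v. \<Sum>k. \<bar>l2_nth v k\<bar> powr q"
  have le: "aug_lagrangian K (lq_penalty q) t p y u \<le> aug_lagrangian K (lq_penalty q) t p y v" for v
    using min by (simp add: is_arg_min_def not_less)
  \<comment> \<open>Comparison with 0, where the functional is finite, shows that J is finite at
    u.\<close>
  have "in_lp q (l2_nth 0)" by (simp add: in_lp_def zero_l2.rep_eq)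
  then show u: "in_lp q (l2_nth u)"
    using le[of 0] by (auto simp: aug_lagrangian_def lq_penalty_def split: if_splits)
  fix v assume v: "in_lp q (l2_nth v)"
  define d where "d = K (v - u)"
  define e where "e = K u - y"
  define G where "G = ?J v - ?J u - (p - t *\<^sub>R e) \<bullet> d"
  have quad: "0 \<le> s * G + s\<^sup>2 * (t / 2 * (d \<bullet> d))" if s: "0 < s" "s < 1" for s
  proof -
    let ?w = "(1 - s) *\<^sub>R u + s *\<^sub>R v"
    have Kw: "K ?w - y = e + s *\<^sub>R d"
      by (simp add: K.add K.diff K.scaleR d_def e_def algebra_simps)
    have w: "in_lp q (l2_nth ?w)" "?J ?w \<le> (1 - s) * ?J u + s * ?J v"
      using lq_penalty_convex_combination[OF _ _ _ _ u v, of "1 - s" s] s q by auto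
    have "t / 2 * (norm e)\<^sup>2 + ?J u - p \<bullet> e \<le> t / 2 * (norm (e + s *\<^sub>R d))\<^sup>2 + ?J ?w - p \<bullet> (e + s *\<^sub>R d)"
      using le[of ?w] unfolding aug_lagrangian_def Kw lq_penalty_eq[OF w(1)] lq_penalty_eq[OF u]
        e_def[symmetric] by simp
    also have "\<dots> \<le> t / 2 * (norm (e + s *\<^sub>R d))\<^sup>2 + ((1 - s) * ?J u + s * ?J v) - p \<bullet> (e + s *\<^sub>R d)"
      using w(2) by simp
    finally show ?thesis
      unfolding power2_norm_eq_inner G_def
      by (simp add: inner_add inner_diff inner_commute power2_eq_square algebra_simps)
  qed
  have "0 \<le> G"
  proof (rule tendsto_lowerbound)
    show "((\<lambda>s. G + s * (t / 2 * (d \<bullet> d))) \<longlongrightarrow> G) (at_right 0)"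
      by (auto intro!: tendsto_eq_intros)
    have "0 \<le> G + s * (t / 2 * (d \<bullet> d))" if "0 < s" "s < 1" for s
    proof -
      have "0 \<le> s * (G + s * (t / 2 * (d \<bullet> d)))"
        using quad[OF that] by (simp add: power2_eq_square algebra_simps)
      then show ?thesis using that by (simp add: zero_le_mult_iff)
    qed
    then show "\<forall>\<^sub>F s in at_right 0. 0 \<le> G + s * (t / 2 * (d \<bullet> d))"
      unfolding eventually_at_right_field by (intro exI[of _ 1]) auto
  qed simp
  moreover have "adjoint K (p + t *\<^sub>R (y - K u)) \<bullet> (v - u) = (p - t *\<^sub>R e) \<bullet> d"
    using inner_adjoint_l2[OF K, of "v - u" "p + t *\<^sub>R (y - K u)"]
    by (simp add: d_def e_def inner_commute algebra_simps)
  ultimately show "?J u + adjoint K (p + t *\<^sub>R (y - K u)) \<bullet> (v - u) \<le> ?J v"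
    by (simp add: G_def)
qed

section \<open>The symmetric Bregman distance of two subgradient pairs\<close>

context
  fixes q :: real and u v \<xi> \<eta> :: l2
  assumes q: "1 < q" "q \<le> 2"
    and \<xi>: "\<xi> \<in> subdifferential (lq_penalty q) u"
    and \<eta>: "\<eta> \<in> subdifferential (lq_penalty q) v"
begin

lemma symmetric_bregman_sums:
  "(\<lambda>k. (powr_deriv q (l2_nth u k) - powr_deriv q (l2_nth v k)) * (l2_nth u k - l2_nth v k))
    sums ((\<xi> - \<eta>) \<bullet> (u - v))"
proof -
  have "(\<lambda>k. l2_nth (\<xi> - \<eta>) k * l2_nth (u - v) k) sums ((\<xi> - \<eta>) \<bullet> (u - v))"
    unfolding inner_l2_eq by (intro summable_sums summable_square_mult summable_l2_nth)
  then show ?thesis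
    using subdifferential_lq_penalty_nth[OF q(1) \<xi>] subdifferential_lq_penalty_nth[OF q(1) \<eta>]
    by (simp add: l2_nth_minus)
qed

text \<open>\<open>abs_diff_powr_le\<close> summed over the coordinates. The weight t is later set
  to the noise level, at which the symmetric Bregman distance divided by t stays bounded.\<close>

lemma lq_distance_le:
  assumes t: "0 < t"
  shows "in_lp q (l2_nth (u - v))"
    and "(\<Sum>k. \<bar>l2_nth (u - v) k\<bar> powr q) \<le> t powr (q / 2) *
      (2 / (q - 1) * ((\<xi> - \<eta>) \<bullet> (u - v)) / t
        + (\<Sum>k. \<bar>l2_nth u k\<bar> powr q) + (\<Sum>k. \<bar>l2_nth v k\<bar> powr q))"
proof -
  let ?f = "\<lambda>k. t powr (q / 2) * (2 / (q - 1) * ((powr_deriv q (l2_nth u k) - powr_deriv q (l2_nth v k))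
    * (l2_nth u k - l2_nth v k)) / t + \<bar>l2_nth u k\<bar> powr q + \<bar>l2_nth v k\<bar> powr q)"
  have f: "?f sums (t powr (q / 2) * (2 / (q - 1) * ((\<xi> - \<eta>) \<bullet> (u - v)) / t
      + (\<Sum>k. \<bar>l2_nth u k\<bar> powr q) + (\<Sum>k. \<bar>l2_nth v k\<bar> powr q)))"
    using subdifferential_lq_penaltyD(1)[OF \<xi>] subdifferential_lq_penaltyD(1)[OF \<eta>]
    unfolding in_lp_def
    by (intro sums_mult sums_add sums_divide symmetric_bregman_sums summable_sums)
  have le: "\<bar>l2_nth (u - v) k\<bar> powr q \<le> ?f k" for k
    unfolding l2_nth_minus by (rule abs_diff_powr_le[OF q t])
  show s: "in_lp q (l2_nth (u - v))"
    unfolding in_lp_def using le by (intro summable_comparison_test'[OF sums_summable[OF f]]) auto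
  show "(\<Sum>k. \<bar>l2_nth (u - v) k\<bar> powr q) \<le> t powr (q / 2) *
      (2 / (q - 1) * ((\<xi> - \<eta>) \<bullet> (u - v)) / t
        + (\<Sum>k. \<bar>l2_nth u k\<bar> powr q) + (\<Sum>k. \<bar>l2_nth v k\<bar> powr q))"
    by (rule sums_le[OF le summable_sums f]) (use s in \<open>simp add: in_lp_def\<close>)
qed

lemma subgradient_distance_le:
  assumes r: "r = q / (q - 1)"
  shows "in_lp r (l2_nth (\<xi> - \<eta>))"
    and "(\<Sum>k. \<bar>l2_nth (\<xi> - \<eta>) k\<bar> powr r) \<le> (2 * q) powr (r - 1) * ((\<xi> - \<eta>) \<bullet> (u - v))"
proof -
  let ?f = "\<lambda>k. (2 * q) powr (r - 1) *
    ((powr_deriv q (l2_nth u k) - powr_deriv q (l2_nth v k)) * (l2_nth u k - l2_nth v k))"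
  have f: "?f sums ((2 * q) powr (r - 1) * ((\<xi> - \<eta>) \<bullet> (u - v)))"
    by (intro sums_mult symmetric_bregman_sums)
  have le: "\<bar>l2_nth (\<xi> - \<eta>) k\<bar> powr r \<le> ?f k" for k
    unfolding l2_nth_minus subdifferential_lq_penalty_nth[OF q(1) \<xi>]
      subdifferential_lq_penalty_nth[OF q(1) \<eta>]
    by (rule powr_deriv_cocoercive[OF q r])
  show s: "in_lp r (l2_nth (\<xi> - \<eta>))"
    unfolding in_lp_def using le by (intro summable_comparison_test'[OF sums_summable[OF f]]) auto
  show "(\<Sum>k. \<bar>l2_nth (\<xi> - \<eta>) k\<bar> powr r) \<le> (2 * q) powr (r - 1) * ((\<xi> - \<eta>) \<bullet> (u - v))"
    by (rule sums_le[OF le summable_sums f]) (use s in \<open>simp add: in_lp_def\<close>)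
qed

end

section \<open>Convergence rates\<close>

theorem proposition6p3:
  fixes K :: "l2 \<Rightarrow> 'b :: {real_inner, polish_space}"
    and q r \<rho> :: real
    and g p0 p_dag :: 'b
    and u_dag :: l2
    and \<tau> \<delta> :: "nat \<Rightarrow> real"
    and gs :: "nat \<Rightarrow> 'b"
    and R :: "nat \<Rightarrow> 'b \<Rightarrow> l2"
    and Rs :: "nat \<Rightarrow> 'b \<Rightarrow> 'b"
  defines "J \<equiv> lq_penalty q"
    and "\<Gamma> \<equiv> morozov K R \<rho>"
  assumes K: "bounded_linear K"
    and q: "1 < q" "q \<le> 2"
    and r: "r = q / (q - 1)"
    and attainable: "\<exists>u. K u = g \<and> J u < \<infinity>"
    and tau_pos: "\<And>n. n \<ge> 1 \<Longrightarrow> \<tau> n > 0"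
    and tau_bdd: "bdd_above (\<tau> ` {1..})"
    and t_infinity: "filterlim (\<lambda>n. \<Sum>k=1..n. \<tau> k) at_top sequentially"
    and alm: "\<And>y. alm_iterates K J \<tau> p0 y (\<lambda>n. R n y) (\<lambda>n. Rs n y)"
    and rho: "\<rho> > 1"
    and delta_pos: "\<And>k. \<delta> k > 0"
    and delta_lim: "\<delta> \<longlonglongrightarrow> 0"
    and noise: "\<And>k. norm (gs k - g) \<le> \<delta> k"
    and u_dag: "is_arg_min J (\<lambda>u. K u = g) u_dag"
    and source: "adjoint K p_dag \<in> subdifferential J u_dag"
  shows "(\<forall>\<^sub>F k in sequentially. in_lp q (l2_nth (R (\<Gamma> (\<delta> k) (gs k)) (gs k) - u_dag))) \<and>
    (\<lambda>k. lp_norm q (l2_nth (R (\<Gamma> (\<delta> k) (gs k)) (gs k) - u_dag)))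
      \<in> O(\<lambda>k. sqrt (\<delta> k)) \<and>
    (\<forall>\<^sub>F k in sequentially. in_lp r (l2_nth
      (adjoint K (Rs (\<Gamma> (\<delta> k) (gs k)) (gs k)) - adjoint K p_dag))) \<and>
    (\<lambda>k. lp_norm r (l2_nth (adjoint K (Rs (\<Gamma> (\<delta> k) (gs k)) (gs k)) - adjoint K p_dag)))
      \<in> O(\<lambda>k. \<delta> k powr ((q - 1) / q))"
proof -
  interpret K: bounded_linear K by fact
  let ?sum = "\<lambda>u. \<Sum>k. \<bar>l2_nth u k\<bar> powr q"
  have adj: "adjoint K z \<bullet> x = z \<bullet> K x" for x z
    using inner_adjoint_l2[OF K, of x z] by (simp add: inner_commute)
  have gd: "K u_dag = g" using u_dag by (simp add: is_arg_min_def)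
  note dag = source[unfolded J_def]
  have dag_lq: "in_lp q (l2_nth u_dag)" using dag by (rule subdifferential_lq_penaltyD)
  have Rs0: "Rs 0 y = p0" for y using alm[of y] by (simp add: alm_iterates_def)
  have upd: "Rs n y = Rs (n - 1) y + \<tau> n *\<^sub>R (y - K (R n y))" if "n \<ge> 1" for n y
    using alm[of y] that unfolding alm_iterates_def by blast
  have sub: "adjoint K (Rs n y) \<in> subdifferential (lq_penalty q) (R n y)" if "n \<ge> 1" for n y
    unfolding upd[OF that]
    by (rule aug_lagrangian_minimizer_subgradient[OF K q(1)])
      (use alm[of y] that in \<open>simp add: alm_iterates_def J_def\<close>)
  note lq = subdifferential_lq_penaltyD(1)[OF sub]
  \<comment> \<open>The adjoint turns the subgradient inequalities in the sequence space into the
    data space inequalities of the locale.\<close>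
  have iterates: "dual_iterates (\<lambda>n. Rs n y) (\<lambda>n. K (R n y)) (\<lambda>n. ?sum (R n y)) \<tau> y g p_dag
      (?sum u_dag) d" if "norm (y - g) \<le> d" for y d
  proof
    fix n m :: nat assume n: "n \<ge> 1"
    show "?sum (R n y) + Rs n y \<bullet> (g - K (R n y)) \<le> ?sum u_dag"
      using subdifferential_lq_penaltyD(2)[OF sub[OF n] dag_lq] by (simp add: adj K.diff gd)
    show "?sum u_dag + p_dag \<bullet> (K (R n y) - g) \<le> ?sum (R n y)"
      using subdifferential_lq_penaltyD(2)[OF dag lq[OF n]] by (simp add: adj K.diff gd)
    show "?sum (R n y) + Rs n y \<bullet> (K (R m y) - K (R n y)) \<le> ?sum (R m y)" if m: "m \<ge> 1"
      using subdifferential_lq_penaltyD(2)[OF sub[OF n] lq[OF m]] by (simp add: adj K.diff)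
  qed (use tau_pos upd that in auto)
  obtain T where T: "\<And>k. k \<ge> 1 \<Longrightarrow> \<tau> k \<le> T"
    using tau_bdd unfolding bdd_above_def by auto
  have T0: "0 < T" using T[of 1] tau_pos[of 1] by simp
  \<comment> \<open>With a common bound on the noise levels, all constants below are independent of
    k and the estimates hold for every k.\<close>
  obtain \<Delta> where \<Delta>: "\<And>k. \<delta> k \<le> \<Delta>"
    using convergent_imp_Bseq[OF convergentI[OF delta_lim]] unfolding Bseq_def
    by (metis abs_le_D1 real_norm_def)
  have \<Delta>0: "0 < \<Delta>" using \<Delta>[of 0] delta_pos[of 0] by simp
  define a where "a = norm (p0 - p_dag)"
  \<comment> \<open>Bounds the dual error at the stopping index: \<open>dual_error_le\<close> with
    the stopping time bound of \<open>discrepancy_principle\<close>, where \<Delta> replaces the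
    noise level.\<close>
  define B where "B = a + (1 + 2 * T * \<Delta> + (a\<^sup>2 / 2 + a + 1 + T * \<Delta>) / (\<rho> * (\<rho> - 1)))"
  \<comment> \<open>Bounds the bracket of \<open>lq_distance_le\<close> at t =
    \<open>\<delta> k\<close>; its summands come from \<open>S k / \<delta> k\<close>, from J at the
    stopped iterate and from J at u_dag.\<close>
  define M where "M = 2 / (q - 1) * (B * (\<rho> + 1)) +
    (?sum u_dag + (B + norm p_dag) * ((\<rho> + 1) * \<Delta>)) + ?sum u_dag"
  have B0: "0 \<le> B" using T0 \<Delta>0 rho by (simp add: B_def a_def)
  define u where "u k = R (\<Gamma> (\<delta> k) (gs k)) (gs k)" for k
  define p where "p k = Rs (\<Gamma> (\<delta> k) (gs k)) (gs k)" for k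
  define S where "S k = (adjoint K (p k) - adjoint K p_dag) \<bullet> (u k - u_dag)" for k
  have stopped: "adjoint K (p k) \<in> subdifferential (lq_penalty q) (u k)"
      "S k \<le> B * (\<rho> + 1) * \<delta> k" "?sum (u k) \<le> ?sum u_dag + (B + norm p_dag) * ((\<rho> + 1) * \<Delta>)" for k
  proof -
    define n where "n = \<Gamma> (\<delta> k) (gs k)"
    interpret it: dual_iterates "\<lambda>n. Rs n (gs k)" "\<lambda>n. K (R n (gs k))" "\<lambda>n. ?sum (R n (gs k))"
      \<tau> "gs k" g p_dag "?sum u_dag" "\<delta> k"
      by (rule iterates[OF noise])
    have unb: "filterlim it.elapsed at_top sequentially"
      using t_infinity unfolding it.elapsed_def[abs_def] .
    have n: "n = (LEAST n. n \<ge> 1 \<and> norm (K (R n (gs k)) - gs k) < \<rho> * \<delta> k)"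
      by (simp add: n_def \<Gamma>_def morozov_def)
    note disc = it.discrepancy_principle[OF rho delta_pos T unb, folded n, unfolded Rs0, folded a_def]
    have u: "u k = R n (gs k)" and p: "p k = Rs n (gs k)" by (simp_all add: u_def p_def n_def)
    show "adjoint K (p k) \<in> subdifferential (lq_penalty q) (u k)"
      unfolding u p by (rule sub[OF disc(1)])
    have "T * \<delta> k \<le> T * \<Delta>" using \<Delta> T0 by simp
    then have "1 + 2 * T * \<delta> k + (a\<^sup>2 / 2 + a + 1 + T * \<delta> k) / (\<rho> * (\<rho> - 1))
        \<le> 1 + 2 * T * \<Delta> + (a\<^sup>2 / 2 + a + 1 + T * \<Delta>) / (\<rho> * (\<rho> - 1))"
      using rho by (intro add_mono divide_right_mono) auto
    then have pB: "norm (p k - p_dag) \<le> B"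
      using it.dual_error_le[of n] disc(3) unfolding p Rs0 B_def a_def by linarith
    have res: "norm (K (u k) - g) \<le> (\<rho> + 1) * \<delta> k"
      using norm_triangle_ineq[of "K (u k) - gs k" "gs k - g"] disc(2) noise[of k]
      by (simp add: u algebra_simps)
    have "S k = (p k - p_dag) \<bullet> (K (u k) - g)"
      by (simp add: S_def inner_diff_left adj K.diff gd)
    also have "\<dots> \<le> norm (p k - p_dag) * norm (K (u k) - g)" by (rule norm_cauchy_schwarz)
    also have "\<dots> \<le> B * ((\<rho> + 1) * \<delta> k)" by (intro mult_mono pB res B0 norm_ge_zero)
    finally show "S k \<le> B * (\<rho> + 1) * \<delta> k" by (simp add: mult.assoc)
    have "norm (p k) \<le> B + norm p_dag"
      using norm_triangle_ineq[of "p k - p_dag" p_dag] pB by simp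
    moreover have "norm (K (u k) - g) \<le> (\<rho> + 1) * \<Delta>"
      by (rule order_trans[OF res]) (use \<Delta> rho in \<open>simp add: mult_left_mono\<close>)
    ultimately have "norm (p k) * norm (K (u k) - g) \<le> (B + norm p_dag) * ((\<rho> + 1) * \<Delta>)"
      using B0 by (intro mult_mono) auto
    moreover have "p k \<bullet> (K (u k) - g) \<le> norm (p k) * norm (K (u k) - g)"
      by (rule norm_cauchy_schwarz)
    \<comment> \<open>Nonnegativity of the Bregman distance keeps J bounded at the stopped
      iterates.\<close>
    moreover have "?sum (u k) \<le> ?sum u_dag + p k \<bullet> (K (u k) - g)"
      using it.subgrad_dag[OF disc(1)] by (simp add: u p inner_diff_right)
    ultimately show "?sum (u k) \<le> ?sum u_dag + (B + norm p_dag) * ((\<rho> + 1) * \<Delta>)"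
      by linarith
  qed
  have primal: "lp_norm q (l2_nth (u k - u_dag)) \<le> M powr (1 / q) * sqrt (\<delta> k)" for k
  proof -
    have "S k / \<delta> k \<le> B * (\<rho> + 1)"
      using stopped(2)[of k] delta_pos[of k] by (simp add: pos_divide_le_eq)
    then have "2 / (q - 1) * (S k / \<delta> k) \<le> 2 / (q - 1) * (B * (\<rho> + 1))"
      using q by (intro mult_left_mono) auto
    then have "2 / (q - 1) * S k / \<delta> k \<le> 2 / (q - 1) * (B * (\<rho> + 1))" by simp
    then have le_M: "2 / (q - 1) * S k / \<delta> k + ?sum (u k) + ?sum u_dag \<le> M"
      using stopped(3)[of k] by (simp add: M_def)
    have "?sum (u k - u_dag)
        \<le> \<delta> k powr (q / 2) * (2 / (q - 1) * S k / \<delta> k + ?sum (u k) + ?sum u_dag)"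
      unfolding S_def by (rule lq_distance_le(2)[OF q stopped(1) dag delta_pos])
    also have "\<dots> \<le> \<delta> k powr (q / 2) * M"
      by (rule mult_left_mono[OF le_M]) simp
    finally have "?sum (u k - u_dag) \<le> \<delta> k powr (q / 2) * M" .
    moreover have "0 \<le> ?sum (u k - u_dag)"
      using lq_distance_le(1)[OF q stopped(1) dag delta_pos, of k]
      by (intro suminf_nonneg) (auto simp: in_lp_def)
    ultimately have "lp_norm q (l2_nth (u k - u_dag)) \<le> (\<delta> k powr (q / 2) * M) powr (1 / q)"
      unfolding lp_norm_def using q by (intro powr_mono2) auto
    also have "\<dots> = \<delta> k powr (1 / 2) * M powr (1 / q)"
      using q by (simp add: powr_mult powr_powr)
    finally show ?thesis using delta_pos[of k] by (simp add: powr_half_sqrt mult.commute)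
  qed
  have dual: "lp_norm r (l2_nth (adjoint K (p k) - adjoint K p_dag))
      \<le> ((2 * q) powr (r - 1) * (B * (\<rho> + 1))) powr (1 / r) * \<delta> k powr ((q - 1) / q)" for k
  proof -
    let ?c = "(2 * q) powr (r - 1)" and ?s = "\<Sum>i. \<bar>l2_nth (adjoint K (p k) - adjoint K p_dag) i\<bar> powr r"
    have "?s \<le> ?c * S k"
      unfolding S_def by (rule subgradient_distance_le(2)[OF q stopped(1) dag r])
    also have "\<dots> \<le> ?c * (B * (\<rho> + 1) * \<delta> k)"
      using stopped(2) by (intro mult_left_mono) auto
    finally have "?s \<le> ?c * (B * (\<rho> + 1)) * \<delta> k" by (simp add: mult.assoc)
    moreover have "0 \<le> ?s"
      using subgradient_distance_le(1)[OF q stopped(1) dag r, of k]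
      by (intro suminf_nonneg) (auto simp: in_lp_def)
    ultimately have "lp_norm r (l2_nth (adjoint K (p k) - adjoint K p_dag))
        \<le> (?c * (B * (\<rho> + 1)) * \<delta> k) powr (1 / r)"
      unfolding lp_norm_def using q r by (intro powr_mono2) auto
    also have "\<dots> = (?c * (B * (\<rho> + 1))) powr (1 / r) * \<delta> k powr (1 / r)"
      by (rule powr_mult)
    \<comment> \<open>The dual rate appears because 1 / r = (q - 1) / q.\<close>
    finally show ?thesis by (simp add: r)
  qed
  have "in_lp q (l2_nth (u k - u_dag))" for k
    by (rule lq_distance_le(1)[OF q stopped(1) dag delta_pos])
  moreover have "in_lp r (l2_nth (adjoint K (p k) - adjoint K p_dag))" for k
    by (rule subgradient_distance_le(1)[OF q stopped(1) dag r])
  moreover have "(\<lambda>k. lp_norm q (l2_nth (u k - u_dag))) \<in> O(\<lambda>k. sqrt (\<delta> k))"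
    using primal delta_pos
    by (intro bigoI[where c = "M powr (1 / q)"] always_eventually)
      (auto simp: lp_norm_def less_imp_le)
  moreover have "(\<lambda>k. lp_norm r (l2_nth (adjoint K (p k) - adjoint K p_dag)))
      \<in> O(\<lambda>k. \<delta> k powr ((q - 1) / q))"
    using dual
    by (intro bigoI[where c = "((2 * q) powr (r - 1) * (B * (\<rho> + 1))) powr (1 / r)"] always_eventually)
      (auto simp: lp_norm_def)
  ultimately show ?thesis unfolding u_def p_def by simp
qed

end
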